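(* Let $R_1,R_2>0$, $R>R_1+R_2$ and $T>0$. Let $a\in C^1([0,\infty);\mathbb R^3)$ satisfy $|a(t)|<R_2$ for all $t\ge 0$, and let $g:[0,\infty)\to\mathbb R$ be continuous and bounded; both $a$ and $g$ are given. Let $\Omega\subset\mathbb R^3$ be a bounded domain such that $\Omega\cap(\mathbb R^3\setminus B_R)$ is not empty. Then the source profile function is uniquely determined by $u(x,T)$ for $x\in\Omega$, in the following sense. Let $f_1,f_2\in L^2(B_R)$ be real-valued profile functions, compactly supported in $B_{R_1}$ and extended by zero to $\mathbb R^3$, and for $k=1,2$ let $u_k$ be the solution of $$\partial_t u_k(x,t)-\Delta u_k(x,t)=f_k(x-a(t))\,g(t)\ \text{ in }\mathbb R^3\times(0,\infty),\qquad u_k(x,0)=0\ \text{ for } x\in\mathbb R^3 .$$ If $u_1(x,T)=u_2(x,T)$ for all $x\in\Omega$, then $f_1=f_2$ (almost everywhere).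
   Context: $B_\rho\subset\mathbb R^3$ denotes the ball of radius $\rho$ centered at the origin. "The solution" of the initial value problem $\partial_t u-\Delta u=f(x-a(t))g(t)$, $u(\cdot,0)=0$, is the unique solution with $u\in L^2(0,T';H^2(\mathbb R^3))$ for every $T'>0$; it is given by Duhamel's formula $$u(x,t)=\int_0^t\int_{\mathbb R^3}G(x-y,t-s)\,f(y-a(s))\,g(s)\,dy\,ds,\qquad G(x,t)=\frac{1}{(4\pi t)^{3/2}}e^{-|x|^2/(4t)},$$ and the pointwise values $u(x,T)$ are understood via this formula.
   Formalization: The formal theorem additionally assumes that g is not identically zero on [0,T]; without this the claim is false, since g = 0 on [0,T] gives u_1(x,T) = u_2(x,T) = 0 for all profile functions f_1, f_2. *)

theory Defs
  imports "HOL-Analysis.Analysis"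
begin

text \<open>Iterated directional derivatives: the first vector of the list is the outermost derivative.\<close>

fun iter_deriv :: "'a list \<Rightarrow> ('a::euclidean_space \<Rightarrow> real) \<Rightarrow> 'a \<Rightarrow> real" where
  "iter_deriv [] f = f"
| "iter_deriv (v # vs) f = (\<lambda>x. frechet_derivative (iter_deriv vs f) (at x) v)"

text \<open>Total differentiability of all iterated derivatives is \<open>C\<^sup>\<infinity>\<close>-smoothness: it makes each of them
  continuous.\<close>

definition smooth_fun :: "('a::euclidean_space \<Rightarrow> real) \<Rightarrow> bool" where
  "smooth_fun f \<longleftrightarrow> (\<forall>vs x. iter_deriv vs f differentiable (at x))"

definition test_fun :: "'a::euclidean_space set \<Rightarrow> ('a \<Rightarrow> real) \<Rightarrow> bool" where
  "test_fun U \<phi> \<longleftrightarrow> smooth_fun \<phi> \<and> (\<exists>K. compact K \<and> K \<subseteq> U \<and> (\<forall>x. x \<notin> K \<longrightarrow> \<phi> x = 0))"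

definition square_integrable_on :: "('a::euclidean_space \<Rightarrow> real) \<Rightarrow> 'a set \<Rightarrow> bool" where
  "square_integrable_on f S \<longleftrightarrow>
     set_borel_measurable lebesgue S f \<and> set_integrable lebesgue S (\<lambda>x. (f x)\<^sup>2)"

text \<open>Elements of \<open>L\<^sup>2\<close> are classes modulo null sets, so the support is the essential one; vanishing
  outside \<open>K\<close> also expresses the extension by zero.\<close>

definition compactly_supported_in :: "('a::euclidean_space \<Rightarrow> real) \<Rightarrow> 'a set \<Rightarrow> bool" where
  "compactly_supported_in f U \<longleftrightarrow>
     (\<exists>K. compact K \<and> K \<subseteq> U \<and> (AE x in lebesgue. x \<notin> K \<longrightarrow> f x = 0))"

definition weak_deriv :: "'a list \<Rightarrow> ('a::euclidean_space \<Rightarrow> real) \<Rightarrow> ('a \<Rightarrow> real) \<Rightarrow> bool" where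
  "weak_deriv vs v w \<longleftrightarrow>
     (\<forall>\<phi>. test_fun UNIV \<phi> \<longrightarrow>
        (LINT x|lebesgue. v x * iter_deriv vs \<phi> x)
          = (-1) ^ length vs * (LINT x|lebesgue. w x * \<phi> x))"

text \<open>\<open>u \<in> L\<^sup>2(0,S;H\<^sup>2(\<real>\<^sup>3))\<close>: the weak spatial derivatives \<open>D vs\<close> of order at most two exist for
  almost every time and are square integrable over the slab \<open>\<real>\<^sup>3 \<times> (0,S)\<close>.\<close>

definition L2_H2 :: "real \<Rightarrow> (real^3 \<Rightarrow> real \<Rightarrow> real) \<Rightarrow> bool" where
  "L2_H2 S u \<longleftrightarrow>
     (\<exists>D :: (real^3) list \<Rightarrow> (real^3) \<times> real \<Rightarrow> real.
        D [] = (\<lambda>(x, t). u x t) \<and>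
        (\<forall>vs. set vs \<subseteq> Basis \<and> length vs \<le> 2 \<longrightarrow>
           square_integrable_on (D vs) (UNIV \<times> {0<..<S}) \<and>
           (AE t in lebesgue. 0 < t \<and> t < S \<longrightarrow>
              weak_deriv vs (\<lambda>x. u x t) (\<lambda>x. D vs (x, t)))))"

definition dt :: "((real^3) \<times> real \<Rightarrow> real) \<Rightarrow> (real^3) \<times> real \<Rightarrow> real" where
  "dt \<phi> = iter_deriv [(0, 1)] \<phi>"

definition laplace_x :: "((real^3) \<times> real \<Rightarrow> real) \<Rightarrow> (real^3) \<times> real \<Rightarrow> real" where
  "laplace_x \<phi> p = (\<Sum>b\<in>Basis. iter_deriv [(b, 0), (b, 0)] \<phi> p)"

text \<open>The equation holds in the sense of distributions on \<open>\<real>\<^sup>3 \<times> (0,\<infinity>)\<close>. The initial condition is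
  attained in \<open>L\<^sup>2(\<real>\<^sup>3)\<close>; the nonnegative integral is used because the Bochner integral of a
  non-integrable function is zero.\<close>

definition heat_ivp_solution ::
  "(real^3 \<Rightarrow> real) \<Rightarrow> (real \<Rightarrow> real^3) \<Rightarrow> (real \<Rightarrow> real) \<Rightarrow> (real^3 \<Rightarrow> real \<Rightarrow> real) \<Rightarrow> bool" where
  "heat_ivp_solution f a g u \<longleftrightarrow>
     (\<forall>S>0. L2_H2 S u) \<and>
     (\<forall>\<phi>. test_fun (UNIV \<times> {0<..}) \<phi> \<longrightarrow>
        (LINT (x, t)|lebesgue. u x t * (- dt \<phi> (x, t) - laplace_x \<phi> (x, t)))
          = (LINT (x, t)|lebesgue. f (x - a t) * g t * \<phi> (x, t))) \<and>
     (\<forall>x. u x 0 = 0) \<and>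
     ((\<lambda>t. \<integral>\<^sup>+x. ennreal ((u x t)\<^sup>2) \<partial>lebesgue) \<longlongrightarrow> 0) (at_right 0)"

definition heat_kernel :: "real^3 \<Rightarrow> real \<Rightarrow> real" where
  "heat_kernel x t = 1 / (4 * pi * t) powr (3/2) * exp (- (norm x)\<^sup>2 / (4 * t))"

definition duhamel ::
  "(real^3 \<Rightarrow> real) \<Rightarrow> (real \<Rightarrow> real^3) \<Rightarrow> (real \<Rightarrow> real) \<Rightarrow> real^3 \<Rightarrow> real \<Rightarrow> real" where
  "duhamel f a g x t =
     (LINT s:{0..t}|lebesgue. (LINT y|lebesgue. heat_kernel (x - y) (t - s) * f (y - a s) * g s))"

text \<open>One-sided derivative at 0, since the curve is only given on \<open>[0,\<infinity>)\<close>.\<close>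

definition C1_halfline :: "(real \<Rightarrow> real^3) \<Rightarrow> bool" where
  "C1_halfline a \<longleftrightarrow>
     (\<exists>a'. continuous_on {0..} a' \<and>
        (\<forall>t\<ge>0. (a has_vector_derivative a' t) (at t within {0..})))"

end

theory Submission
  imports Defs "HOL-Complex_Analysis.Complex_Analysis" "HOL-Probability.Probability"
begin

text \<open>By linearity take \<open>F = f\<^sub>1 - f\<^sub>2\<close> with final state \<open>W\<close>. Along lines outside of the ball of radius
  \<open>R\<^sub>1 + R\<^sub>2\<close> the function \<open>W\<close> is real analytic, so it vanishes in the whole exterior, which is connected. For a
  unit vector \<open>e\<close>, the Laplace transforms \<open>M\<close> of \<open>W\<close> and \<open>L\<close> of \<open>F\<close> in direction \<open>e\<close> are thus both entire of
  exponential type, and \<open>M = L H\<close> with \<open>H z = \<integral>\<^sub>0\<^sup>T g(s) exp (z\<^sup>2 (T - s) + z e \<bullet> a(s)) ds\<close>. If \<open>L\<close> is not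
  identically zero, the quotient \<open>H\<close> is of exponential type as well. Because of the factor \<open>z\<^sup>2\<close> this forces the
  same integral over \<open>[0,t]\<close>, multiplied by \<open>exp (- z e \<bullet> a(t))\<close>, to be of type zero on the real axis for every
  \<open>t < T\<close>; by Phragmen-Lindelof and Liouville it is zero, and at \<open>z = 0\<close> this says that \<open>g\<close> integrates to zero over
  \<open>[0,t]\<close>. So \<open>g\<close> would vanish on \<open>[0,T]\<close>. Hence all \<open>L\<close> are zero, and \<open>F = 0\<close> since exponentials are
  dense in the continuous functions on a ball.\<close>

text \<open>Two obstacles shape the proof. First, that \<open>M\<close> and \<open>L\<close> have
  exponential type does not by itself bound \<open>M / L\<close>, since \<open>L\<close> may be
  small or zero at many points. A lower bound for \<open>L\<close> on discs is needed, and it comes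
  from removing its zeros and applying a Harnack inequality to what is left. Second, a bound on
  \<open>H\<close> at the final time \<open>T\<close> must be carried to earlier times
  \<open>t\<close>. The weight exp (z^2 (t - s)) is huge for s < t and tiny for s > t when Re (z^2)
  is large and positive. Up to an error of Gaussian decay, the integral over the past of
  \<open>t\<close> is then minus the integral over a short future interval, which cannot grow faster
  than exp (z e . a(t)) up to an arbitrarily small rate. This works only in a cone around the real
  axis. On the imaginary axis the weight is at most 1 for s < t and the past integral is bounded
  directly. The two sectors in between are narrower than a right angle, so exponential type is
  enough to interpolate there. The exponent z^2 (T - s) is the logarithm of the exponential moment
  of the heat kernel at time T - s.\<close>

section \<open>Entire functions of exponential type\<close>

text \<open>Since \<open>f\<close> has no zeros, ln A - ln |f| is a positive harmonic function, and
  Harnack's inequality at half the radius has the constant (1 + 1/2) / (1 - 1/2) = 3. This is where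
  the third power comes from. Harnack itself is derived from the Schwarz lemma.\<close>

lemma Harnack_half_disc:
  fixes f :: "complex \<Rightarrow> complex"
  assumes "0 < s" and holf: "f holomorphic_on ball 0 s"
    and nz: "\<And>z. norm z < s \<Longrightarrow> f z \<noteq> 0"
    and bd: "\<And>z. norm z < s \<Longrightarrow> norm (f z) < A"
    and z: "norm z \<le> s / 2"
  shows "norm (f 0) ^ 3 \<le> norm (f z) * A\<^sup>2"
proof -
  have A: "A > 0" using bd[of 0] \<open>0 < s\<close> order_le_less_trans[OF norm_ge_zero[of "f 0"]] by simp
  obtain \<phi> where hol\<phi>: "\<phi> holomorphic_on ball 0 s" and \<phi>: "\<And>z. z \<in> ball 0 s \<Longrightarrow> f z = exp (\<phi> z)"
  proof (rule contractible_imp_holomorphic_log[OF holf convex_imp_contractible[OF convex_ball]])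
    show "f z \<noteq> 0" if "z \<in> ball 0 s" for z using nz that by simp
  qed blast
  define c where "c = ln A - Re (\<phi> 0)"
  \<comment> \<open>Subtracting \<open>\<phi> 0\<close> makes \<open>p 0\<close> the real number
    \<open>c\<close>, while the real part of \<open>p\<close> is still ln A - ln |f|.\<close>
  define p where "p z = c - (\<phi> z - \<phi> 0)" for z
  have Rep: "Re (p z) = ln A - ln (norm (f z))" if "norm z < s" for z
    using \<phi>[of z] that by (simp add: p_def c_def)
  have Repos: "Re (p z) > 0" if "norm z < s" for z
    using Rep[OF that] bd[OF that] A nz[OF that] by simp
  have p0: "p 0 = of_real c" by (simp add: p_def)
  have c: "c > 0" using Repos[of 0] p0 \<open>0 < s\<close> by simp
  \<comment> \<open>The Cayley transform sends the right half plane to the unit disc and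
    \<open>c\<close> to 0, so the Schwarz lemma applies after rescaling the disc.\<close>
  define k where "k w = (p (s * w) - c) / (p (s * w) + c)" for w :: complex
  have sw: "norm (of_real s * w) < s" if "norm w < 1" for w :: complex
    using that \<open>0 < s\<close> by (simp add: norm_mult)
  have pc: "p (s * w) + c \<noteq> 0" if "norm w < 1" for w :: complex
  proof
    assume "p (s * w) + c = 0"
    then have "Re (p (s * w)) + c = 0" by (simp add: complex_eq_iff)
    then show False using Repos[OF sw[OF that]] c by simp
  qed
  have "p holomorphic_on ball 0 s" unfolding p_def by (intro holomorphic_intros hol\<phi>)
  then have "(p \<circ> (\<lambda>w. s * w)) holomorphic_on ball 0 1"
    by (rule holomorphic_on_compose_gen[rotated]) (use sw in \<open>auto intro!: holomorphic_intros\<close>)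
  then have "(\<lambda>w. p (s * w)) holomorphic_on ball 0 1" by (simp add: o_def)
  then have "k holomorphic_on ball 0 1" unfolding k_def
    using pc by (intro holomorphic_intros) auto
  moreover have "k 0 = 0" using p0 by (simp add: k_def)
  moreover have k1: "norm (k w) < 1" if "norm w < 1" for w :: complex
  proof -
    have "(norm (p (s * w) - c))\<^sup>2 < (norm (p (s * w) + c))\<^sup>2"
      using Repos[OF sw[OF that]] c unfolding cmod_power2 by (simp add: power2_eq_square algebra_simps)
    then have "norm (p (s * w) - c) < norm (p (s * w) + c)" by (rule power2_less_imp_less) simp
    then show ?thesis by (simp add: k_def norm_divide divide_simps)
  qed
  ultimately have kw: "norm (k w) \<le> norm w" if "norm w < 1" for w
    using that by (intro Schwarz_Lemma(1)) auto
  define w where "w = z / s"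
  have zw: "z = s * w" using \<open>0 < s\<close> by (simp add: w_def)
  have w2: "norm w \<le> 1/2" using z \<open>0 < s\<close> by (simp add: w_def norm_divide divide_simps)
  have "norm (k w) \<le> 1/2" using kw[of w] w2 by linarith
  have "norm (p z - c) \<le> norm (p z + c) / 2"
  proof -
    have "norm (p z - c) = norm (k w) * norm (p z + c)"
      using pc[of w] w2 by (simp add: k_def zw norm_divide)
    then show ?thesis using \<open>norm (k w) \<le> 1/2\<close> mult_right_mono[of "norm (k w)" "1/2" "norm (p z + c)"] by simp
  qed
  moreover have "norm (p z + c) \<le> norm (p z - c) + 2 * c"
    using norm_triangle_ineq[of "p z - c" "2 * of_real c"] c by (simp add: norm_mult add.commute)
  ultimately have "norm (p z - c) \<le> c * 2" by linarith
  moreover have "norm (p z) \<le> norm (p z - c) + c" using norm_triangle_ineq[of "p z - c" "of_real c"] c by simp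
  ultimately have "Re (p z) \<le> 3 * c" using complex_Re_le_cmod[of "p z"] by linarith
  moreover have zs: "norm z < s" using z \<open>0 < s\<close> by linarith
  ultimately have "ln A - ln (norm (f z)) \<le> 3 * (ln A - ln (norm (f 0)))"
    using Rep[of z] Rep[of 0] p0 \<open>0 < s\<close> by simp
  moreover have "norm (f z) > 0" "norm (f 0) > 0" using nz zs \<open>0 < s\<close> by auto
  ultimately have "ln (norm (f 0) ^ 3) \<le> ln (norm (f z) * A\<^sup>2)"
    using A by (simp add: ln_mult ln_realpow)
  then show ?thesis using A \<open>norm (f z) > 0\<close> \<open>norm (f 0) > 0\<close> by simp
qed

lemma norm_le_of_sphere:
  fixes f :: "complex \<Rightarrow> complex"
  assumes "f holomorphic_on UNIV" and "0 < r"
    and "\<And>z. norm z = r \<Longrightarrow> norm (f z) \<le> A" and "norm z \<le> r"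
  shows "norm (f z) \<le> A"
proof (rule maximum_modulus_frontier[of f "cball 0 r"])
  show "f holomorphic_on interior (cball 0 r)" using assms(1) holomorphic_on_subset by blast
  show "continuous_on (closure (cball 0 r)) f"
    using assms(1) holomorphic_on_imp_continuous_on continuous_on_subset by blast
qed (use assms in \<open>auto simp: frontier_cball\<close>)

text \<open>The zeros of \<open>f\<close> in the disc of radius \<open>s\<close> are removed one at a time: dividing by the Blaschke
  factor of the disc of radius \<open>r\<close> leaves \<open>\<bar>f\<bar>\<close> unchanged on the circle and increases \<open>\<bar>f 0\<bar>\<close> at least by the
  factor \<open>r / s\<close>, so that the maximum principle bounds the number \<open>n\<close> of steps.\<close>

lemma quotient_bound_aux:
  fixes f h :: "complex \<Rightarrow> complex"
  assumes "0 < s" "s < r" and h: "h holomorphic_on UNIV"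
  shows "f holomorphic_on UNIV \<Longrightarrow> f 0 \<noteq> 0 \<Longrightarrow>
    (\<And>z. norm z = r \<Longrightarrow> norm (f z) \<le> A) \<Longrightarrow> (\<And>z. norm z = r \<Longrightarrow> norm (f z * h z) \<le> B) \<Longrightarrow>
    norm (f 0) > A * (s / r) ^ n \<Longrightarrow> norm z \<le> s / 2 \<Longrightarrow> norm (h z) * norm (f 0) ^ 3 \<le> B * (2 * A)\<^sup>2"
proof (induction n arbitrary: f)
  \<comment> \<open>With no steps left, the lower bound on |f 0| contradicts the maximum
    principle.\<close>
  case 0
  have "norm (f 0) \<le> A" by (rule norm_le_of_sphere[of f r]) (use 0 assms in auto)
  then show ?case using 0 by simp
next
  case (Suc n)
  have r: "r > 0" using assms by simp
  have fA: "norm (f w) \<le> A" if "norm w \<le> r" for w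
    by (rule norm_le_of_sphere[of f r]) (use Suc that r in auto)
  have A: "A > 0" using fA[of 0] Suc.prems(2) r by (smt (verit) norm_zero zero_less_norm_iff)
  have fhB: "norm (f w * h w) \<le> B" if "norm w \<le> r" for w
    by (rule norm_le_of_sphere[of "\<lambda>w. f w * h w" r]) (use Suc that r h in \<open>auto intro!: holomorphic_intros\<close>)
  show ?case
  proof (cases "\<exists>a. norm a < s \<and> f a = 0")
    case False
    \<comment> \<open>The bound \<open>2 * A\<close> replaces \<open>A\<close> because Harnack is
      stated with a strict inequality.\<close>
    have "norm (f 0) ^ 3 \<le> norm (f z) * (2 * A)\<^sup>2"
    proof (rule Harnack_half_disc[of s])
      show "f holomorphic_on ball 0 s" using Suc.prems(1) holomorphic_on_subset by blast
      show "norm (f z) < 2 * A" if "norm z < s" for z using fA[of z] that A assms by simp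
    qed (use False assms Suc.prems in auto)
    then have "norm (h z) * norm (f 0) ^ 3 \<le> norm (h z) * (norm (f z) * (2 * A)\<^sup>2)"
      by (intro mult_left_mono) auto
    also have "\<dots> = norm (f z * h z) * (2 * A)\<^sup>2" by (simp add: norm_mult)
    also have "\<dots> \<le> B * (2 * A)\<^sup>2" using Suc.prems(6) assms by (intro mult_right_mono fhB) auto
    finally show ?thesis .
  next
    case True
    then obtain a where a: "norm a < s" "f a = 0" by blast
    have a0: "a \<noteq> 0" using a Suc.prems(2) by auto
    define q where "q z = (if z = a then deriv f a else f z / (z - a))" for z
    have holq: "q holomorphic_on UNIV"
      by (rule pole_theorem_open_0[OF Suc.prems(1), of a]) (auto simp: q_def a)
    \<comment> \<open>This is \<open>f\<close> divided by the Blaschke factor r (z - a) / (r^2 - cnj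
      a z), with the removable singularity at \<open>a\<close> filled in by
      \<open>q\<close>.\<close>
    define f1 where "f1 z = q z * ((r\<^sup>2 - cnj a * z) / r)" for z
    have holf1: "f1 holomorphic_on UNIV" unfolding f1_def using r by (intro holomorphic_intros holq) auto
    have fq: "f z = q z * (z - a)" for z by (simp add: q_def a)
    have sph: "norm (f1 z) = norm (f z)" if "norm z = r" for z
    proof -
      have "r\<^sup>2 - cnj a * z = z * cnj (z - a)"
        using that by (simp add: algebra_simps complex_norm_square[symmetric])
      then show ?thesis using that r
        by (simp add: f1_def fq norm_mult norm_divide complex_mod_cnj del: complex_cnj_diff)
    qed
    have f10: "norm (f1 0) = norm (f 0) * (r / norm a)"
      using a0 r by (simp add: f1_def fq norm_mult power2_eq_square)
    have ra: "r / s \<le> r / norm a" "1 \<le> r / norm a" using a a0 r assms by (auto simp: divide_simps)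
    have "A * (s / r) ^ n < norm (f 0) * (r / s)"
      using Suc.prems(5) r assms by (simp add: field_simps)
    also have "\<dots> \<le> norm (f1 0)" unfolding f10 using ra by (intro mult_left_mono) auto
    finally have n: "A * (s / r) ^ n < norm (f1 0)" .
    have ge: "norm (f 0) \<le> norm (f1 0)" unfolding f10 using ra mult_left_mono[of 1 "r / norm a" "norm (f 0)"] by simp
    have "norm (h z) * norm (f1 0) ^ 3 \<le> B * (2 * A)\<^sup>2"
    proof (rule Suc.IH[OF holf1 _ _ _ n])
      show "f1 0 \<noteq> 0" using ge Suc.prems(2) by auto
    qed (use Suc.prems sph in \<open>auto simp: norm_mult\<close>)
    moreover have "norm (h z) * norm (f 0) ^ 3 \<le> norm (h z) * norm (f1 0) ^ 3"
      by (intro mult_left_mono power_mono ge) auto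
    ultimately show ?thesis by linarith
  qed
qed

text \<open>After moving \<open>z0\<close> to the origin, the previous estimate is used on discs
  whose radii grow linearly with |z|. The bounds on the circle are then exponential in |z|, while |f
  z0| is a fixed positive number.\<close>

lemma exponential_type_quotient:
  fixes f h :: "complex \<Rightarrow> complex"
  assumes "f holomorphic_on UNIV" "h holomorphic_on UNIV" and f0: "f z0 \<noteq> 0"
    and f: "\<And>z. norm (f z) \<le> C * exp (K * norm z)"
    and fh: "\<And>z. norm (f z * h z) \<le> D * exp (K * norm z)" and "K \<ge> 0"
  obtains C' K' where "C' > 0" "K' \<ge> 0" "\<And>z. norm (h z) \<le> C' * exp (K' * norm z)"
proof -
  define F where "F z = f (z + z0)" for z
  define G where "G z = h (z + z0)" for z
  have hol: "F holomorphic_on UNIV" "G holomorphic_on UNIV" unfolding F_def G_def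
    using holomorphic_on_compose_gen[of "\<lambda>z. z + z0" UNIV f UNIV] holomorphic_on_compose_gen[of "\<lambda>z. z + z0" UNIV h UNIV] assms
    by (simp_all add: o_def holomorphic_intros)
  have C: "C \<ge> 0" using f[of 0] order_trans[OF norm_ge_zero f[of 0]] by simp
  have D: "D \<ge> 0" using order_trans[OF norm_ge_zero fh[of 0]] by simp
  define k where "k = norm z0"
  define C2 where "C2 = D * (2 * C)\<^sup>2 / norm (f z0) ^ 3"
  have main: "norm (G z) \<le> C2 * exp (3 * K * (4 * norm z + 4 + k))" for z
  proof -
    \<comment> \<open>The ratio s / r is 1/2 and |z| <= s / 2, as the disc estimate requires. The
      summands 4 and 2 keep the radii positive at z = 0.\<close>
    define r where "r = 4 * norm z + 4"
    define s where "s = 2 * norm z + 2"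
    have rs: "0 < s" "s < r" "norm z \<le> s / 2"
      using norm_ge_zero[of z] unfolding r_def s_def add_divide_distrib by linarith+
    define A where "A = C * exp (K * (r + k))"
    define B where "B = D * exp (K * (r + k))"
    have le: "norm (w + z0) \<le> r + k" if "norm w = r" for w
      using norm_triangle_ineq[of w z0] that by (simp add: k_def)
    have le': "exp (K * norm (w + z0)) \<le> exp (K * (r + k))" if "norm w = r" for w
      using le[OF that] \<open>K \<ge> 0\<close> by (simp add: mult_left_mono)
    have "(\<lambda>n. A * (s / r) ^ n) \<longlonglongrightarrow> A * 0"
      using rs by (intro tendsto_intros LIMSEQ_power_zero) auto
    \<comment> \<open>Any \<open>n\<close> with this property will do, because the resulting bound
      does not depend on \<open>n\<close>.\<close>
    then have "eventually (\<lambda>n. A * (s / r) ^ n < norm (F 0)) sequentially"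
      by (rule order_tendstoD) (simp add: F_def f0)
    then obtain n where n: "A * (s / r) ^ n < norm (F 0)" by (auto simp: eventually_sequentially)
    have "norm (G z) * norm (F 0) ^ 3 \<le> B * (2 * A)\<^sup>2"
    proof (rule quotient_bound_aux[OF rs(1,2) hol(2) hol(1) _ _ _ n rs(3)])
      show "F 0 \<noteq> 0" by (simp add: F_def f0)
      show "norm (F w) \<le> A" if "norm w = r" for w
        unfolding F_def A_def using f[of "w + z0"] le'[OF that] C by (meson mult_left_mono order_trans)
      show "norm (F w * G w) \<le> B" if "norm w = r" for w
        unfolding F_def G_def B_def using fh[of "w + z0"] le'[OF that] D by (meson mult_left_mono order_trans)
    qed
    \<comment> \<open>One factor from \<open>B\<close> and two from \<open>A\<close> give the rate
      3K.\<close>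
    also have "B * (2 * A)\<^sup>2 = D * (2 * C)\<^sup>2 * exp (3 * K * (r + k))"
    proof -
      have "exp (K * (r + k)) * (exp (K * (r + k)))\<^sup>2 = exp (3 * K * (r + k))"
        by (simp add: exp_double[symmetric] exp_add[symmetric])
      then show ?thesis by (simp add: A_def B_def power_mult_distrib mult_ac)
    qed
    finally show ?thesis using f0 by (simp add: F_def C2_def r_def field_simps)
  qed
  define C' where "C' = C2 * exp (3 * K * (4 * k + 4 + k)) + 1"
  have C2: "C2 \<ge> 0" unfolding C2_def using D by simp
  show ?thesis
  proof
    show "C' > 0" unfolding C'_def using C2 by (smt (verit) exp_gt_zero mult_nonneg_nonneg)
    show "12 * K \<ge> 0" using assms by simp
    fix z
    have "norm (h z) = norm (G (z - z0))" by (simp add: G_def)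
    also have "\<dots> \<le> C2 * exp (3 * K * (4 * norm (z - z0) + 4 + k))" by (rule main)
    also have "\<dots> \<le> C2 * exp (3 * K * (4 * (norm z + k) + 4 + k))"
      unfolding k_def using C2 \<open>K \<ge> 0\<close> norm_triangle_ineq4[of z z0] by (intro mult_left_mono) (auto intro!: mult_left_mono)
    also have "\<dots> = C2 * exp (3 * K * (4 * k + 4 + k)) * exp (12 * K * norm z)"
      by (simp add: exp_add[symmetric] algebra_simps)
    also have "\<dots> \<le> C' * exp (12 * K * norm z)" unfolding C'_def by (simp add: algebra_simps)
    finally show "norm (h z) \<le> C' * exp (12 * K * norm z)" .
  qed
qed

section \<open>Phragmen-Lindelof principles\<close>

text \<open>The common scheme of the versions below: multiply by exp (- \<eta> k), apply the maximum
  principle on a large truncation of \<open>S\<close>, and let \<eta> tend to 0. The gauge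
  \<open>k\<close> only has to beat the growth of \<open>f\<close> at infinity.\<close>

lemma Phragmen_Lindelof_gauge:
  fixes f k :: "complex \<Rightarrow> complex"
  assumes S: "closed S" and f: "f holomorphic_on UNIV" and k: "k holomorphic_on interior S" "continuous_on S k"
    and kpos: "\<And>z. z \<in> S \<Longrightarrow> Re (k z) \<ge> 0"
    and growth: "\<And>\<eta>. \<eta> > 0 \<Longrightarrow> \<exists>r0. \<forall>z\<in>S. norm z \<ge> r0 \<longrightarrow> norm (f z) * exp (- \<eta> * Re (k z)) \<le> M"
    and bd: "\<And>z. z \<in> frontier S \<Longrightarrow> norm (f z) \<le> M" and z: "z \<in> S"
  shows "norm (f z) \<le> M"
proof -
  have fz: "norm (f z) * exp (- \<eta> * Re (k z)) \<le> M" if \<eta>: "\<eta> > 0" for \<eta>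
  proof -
    obtain r0 where r0: "\<And>w. w \<in> S \<Longrightarrow> norm w \<ge> r0 \<Longrightarrow> norm (f w) * exp (- \<eta> * Re (k w)) \<le> M"
      using growth[OF \<eta>] by blast
    define r where "r = max r0 (norm z)"
    define F where "F w = f w * exp (- of_real \<eta> * k w)" for w
    have nF: "norm (F w) = norm (f w) * exp (- \<eta> * Re (k w))" for w by (simp add: F_def norm_mult)
    have fS: "f holomorphic_on interior S" "continuous_on S f"
      using f holomorphic_on_subset holomorphic_on_imp_continuous_on continuous_on_subset by blast+
    have "norm (F z) \<le> M"
    proof (rule maximum_modulus_frontier[of F "S \<inter> cball 0 r"])
      have "F holomorphic_on interior S" unfolding F_def by (intro holomorphic_intros fS k)
      then show "F holomorphic_on interior (S \<inter> cball 0 r)" by (rule holomorphic_on_subset) auto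
      have "continuous_on S F" unfolding F_def by (intro continuous_intros fS k)
      then show "continuous_on (closure (S \<inter> cball 0 r)) F" using S by (simp add: closed_Int continuous_on_subset)
      show "bounded (S \<inter> cball 0 r)" by (simp add: bounded_Int)
      show "z \<in> S \<inter> cball 0 r" using z by (simp add: r_def)
      fix w assume w: "w \<in> frontier (S \<inter> cball 0 r)"
      have wS: "w \<in> S" "norm w \<le> r" using w frontier_subset_closed[of "S \<inter> cball 0 r"] closed_Int[OF S closed_cball[of 0 r]] by auto
      have "w \<in> frontier S \<or> norm w = r"
        using w frontier_Int_subset[of S "cball 0 r"] by (auto simp: frontier_cball)
      then show "norm (F w) \<le> M"
      proof
        assume "norm w = r"
        then show ?thesis unfolding nF using wS by (intro r0) (auto simp: r_def)
      next
        assume "w \<in> frontier S"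
        then have "norm (f w) \<le> M" by (rule bd)
        moreover have "exp (- \<eta> * Re (k w)) \<le> 1" using kpos[OF wS(1)] \<eta> by simp
        ultimately show ?thesis unfolding nF using mult_left_mono[of "exp (- \<eta> * Re (k w))" 1 "norm (f w)"] by simp
      qed
    qed
    then show ?thesis by (simp add: nF)
  qed
  have "((\<lambda>\<eta>. norm (f z) * exp (- \<eta> * Re (k z))) \<longlongrightarrow> norm (f z) * exp (- 0 * Re (k z))) (at_right 0)"
    by (intro tendsto_intros)
  then have "norm (f z) * exp (- 0 * Re (k z)) \<le> M"
    by (rule tendsto_upperbound) (use fz in \<open>auto simp: eventually_at_right_less eventually_at_filter\<close>)
  then show ?thesis by simp
qed

text \<open>For slope below 1 the cone is narrower than a right angle, so Re (z^2) is at least a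
  positive multiple of |z|^2 there and outgrows every exponential type.\<close>

lemma Phragmen_Lindelof_cone:
  fixes f :: "complex \<Rightarrow> complex"
  assumes f: "f holomorphic_on UNIV" and \<kappa>: "0 < \<kappa>" "\<kappa> < 1" and M: "M > 0"
    and growth: "\<And>z. \<bar>Im z\<bar> \<le> \<kappa> * Re z \<Longrightarrow> norm (f z) \<le> C * exp (K * norm z)"
    and bd: "\<And>x. x \<ge> 0 \<Longrightarrow> norm (f (Complex x (\<kappa> * x))) \<le> M" "\<And>x. x \<ge> 0 \<Longrightarrow> norm (f (Complex x (- \<kappa> * x))) \<le> M"
    and z: "\<bar>Im z\<bar> \<le> \<kappa> * Re z"
  shows "norm (f z) \<le> M"
proof (rule Phragmen_Lindelof_gauge[of "{z. \<bar>Im z\<bar> \<le> \<kappa> * Re z}" f "\<lambda>z. z\<^sup>2"])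
  let ?S = "{z. \<bar>Im z\<bar> \<le> \<kappa> * Re z}"
  show "closed ?S" by (intro closed_Collect_le continuous_intros)
  define c where "c = (1 - \<kappa>\<^sup>2) / 2"
  have \<kappa>2: "\<kappa>\<^sup>2 < 1" using \<kappa> by (simp add: power_less_one_iff)
  then have c: "c > 0" by (simp add: c_def)
  have sq: "Re (w\<^sup>2) \<ge> c * (norm w)\<^sup>2" if "w \<in> ?S" for w
  proof -
    have "(Im w)\<^sup>2 \<le> (\<kappa> * Re w)\<^sup>2" using that by (auto intro: abs_le_square_iff[THEN iffD1] order_trans)
    then have i: "(Im w)\<^sup>2 \<le> \<kappa>\<^sup>2 * (Re w)\<^sup>2" by (simp add: power_mult_distrib)
    have "(1 - \<kappa>\<^sup>2) * ((Re w)\<^sup>2 + (Im w)\<^sup>2) \<le> (1 - \<kappa>\<^sup>2) * (2 * (Re w)\<^sup>2)"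
      using i \<kappa>2 mult_right_mono[of "\<kappa>\<^sup>2" 1 "(Re w)\<^sup>2"] by (intro mult_left_mono) auto
    moreover have "(1 - \<kappa>\<^sup>2) * (Re w)\<^sup>2 \<le> (Re w)\<^sup>2 - (Im w)\<^sup>2" using i by (simp add: algebra_simps)
    ultimately show ?thesis
      by (simp add: c_def cmod_power2 power2_eq_square[of w]) (simp add: power2_eq_square)
  qed
  show "Re (w\<^sup>2) \<ge> 0" if "w \<in> ?S" for w
    using sq[OF that] c by (meson less_eq_real_def mult_nonneg_nonneg order_trans zero_le_power2)
  show "\<exists>r0. \<forall>w\<in>?S. norm w \<ge> r0 \<longrightarrow> norm (f w) * exp (- \<eta> * Re (w\<^sup>2)) \<le> M" if \<eta>: "\<eta> > 0" for \<eta>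
  proof -
    have "((\<lambda>r::real. C * exp (K * r) * exp (- \<eta> * (c * r\<^sup>2))) \<longlongrightarrow> 0) at_top"
    proof -
      have "c * \<eta> > 0" using c \<eta> by simp
      have lim: "((\<lambda>r::real. exp (K * r - e * r\<^sup>2)) \<longlongrightarrow> 0) at_top" if "e > 0" for e :: real
      proof (cases K "0 :: real" rule: linorder_cases)
        case less then show ?thesis using that by real_asymp
      next
        case equal then show ?thesis using that by (simp, real_asymp)
      next
        case greater then show ?thesis using that by real_asymp
      qed
      from lim[OF \<open>c * \<eta> > 0\<close>] show ?thesis using tendsto_mult_right_zero[of "\<lambda>r. exp (K * r - c * \<eta> * r\<^sup>2)" at_top C]
        by (simp add: exp_diff exp_minus field_simps)
    qed
    then have "eventually (\<lambda>r. C * exp (K * r) * exp (- \<eta> * (c * r\<^sup>2)) < M) at_top"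
      by (rule order_tendstoD) (rule M)
    then obtain r0 where r0: "\<And>r. r \<ge> r0 \<Longrightarrow> C * exp (K * r) * exp (- \<eta> * (c * r\<^sup>2)) < M"
      by (auto simp: eventually_at_top_linorder)
    have "norm (f w) * exp (- \<eta> * Re (w\<^sup>2)) \<le> M" if w: "w \<in> ?S" "norm w \<ge> r0" for w
    proof -
      have "norm (f w) * exp (- \<eta> * Re (w\<^sup>2)) \<le> C * exp (K * norm w) * exp (- \<eta> * (c * (norm w)\<^sup>2))"
        using growth[of w] w(1) sq[OF w(1)] \<eta> order_trans[OF norm_ge_zero growth[of w]]
        by (intro mult_mono) (auto intro!: mult_left_mono)
      then show ?thesis using r0[OF w(2)] by simp
    qed
    then show ?thesis by blast
  qed
  show "norm (f w) \<le> M" if w: "w \<in> frontier ?S" for w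
  proof -
    have wS: "w \<in> ?S" using w \<open>closed ?S\<close> frontier_subset_closed by blast
    have "open {z. \<bar>Im z\<bar> < \<kappa> * Re z}" by (intro open_Collect_less continuous_intros)
    then have "{z. \<bar>Im z\<bar> < \<kappa> * Re z} \<subseteq> interior ?S" by (intro interior_maximal) auto
    moreover have "w \<notin> interior ?S" using w by (simp add: frontier_def)
    ultimately have eq: "\<bar>Im w\<bar> = \<kappa> * Re w" using wS by force
    then have "Re w \<ge> 0" using \<kappa> by (metis abs_ge_zero zero_le_mult_iff less_le_not_le)
    then show ?thesis
      using bd[of "Re w"] eq complex_eq_iff[of w "Complex (Re w) (\<kappa> * Re w)"] complex_eq_iff[of w "Complex (Re w) (- \<kappa> * Re w)"]
      by (cases "Im w \<ge> 0") auto
  qed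
qed (use z f in \<open>auto intro!: holomorphic_intros continuous_intros\<close>)

text \<open>For a function already known to be bounded, the weak gauge \<open>csqrt (1 + z)\<close>
  is enough. The shift by 1 keeps the half plane away from the branch cut. The gain is that the a
  priori bound \<open>B\<close> disappears from the conclusion.\<close>

lemma Phragmen_Lindelof_half_plane:
  fixes f :: "complex \<Rightarrow> complex"
  assumes f: "f holomorphic_on UNIV" and M: "M > 0"
    and bounded: "\<And>z. Re z \<ge> 0 \<Longrightarrow> norm (f z) \<le> B"
    and bd: "\<And>y. norm (f (Complex 0 y)) \<le> M" and z: "Re z \<ge> 0"
  shows "norm (f z) \<le> M"
proof (rule Phragmen_Lindelof_gauge[of "{z. 0 \<le> Re z}" f "\<lambda>z. csqrt (1 + z)"])
  have np: "1 + w \<notin> \<real>\<^sub>\<le>\<^sub>0" if "Re w \<ge> 0" for w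
    using that by (auto simp: complex_nonpos_Reals_iff)
  show "closed {z. 0 \<le> Re z}" by (intro closed_Collect_le continuous_intros)
  have *: "(\<lambda>z. csqrt (1 + z)) holomorphic_on {z. 0 \<le> Re z}"
    using np by (intro holomorphic_intros) auto
  show "(\<lambda>z. csqrt (1 + z)) holomorphic_on interior {z. 0 \<le> Re z}"
    by (rule holomorphic_on_subset[OF * interior_subset])
  show "continuous_on {z. 0 \<le> Re z} (\<lambda>z. csqrt (1 + z))" using * by (rule holomorphic_on_imp_continuous_on)
  show "Re (csqrt (1 + w)) \<ge> 0" for w using csqrt_principal[of "1 + w"] by auto
  show "\<exists>r0. \<forall>w\<in>{z. 0 \<le> Re z}. norm w \<ge> r0 \<longrightarrow> norm (f w) * exp (- \<eta> * Re (csqrt (1 + w))) \<le> M" if \<eta>: "\<eta> > 0" for \<eta>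
  proof -
    have "((\<lambda>r::real. B * exp (- \<eta> * sqrt (r / 2))) \<longlongrightarrow> 0) at_top" using \<eta> by real_asymp
    then have "eventually (\<lambda>r. B * exp (- \<eta> * sqrt (r / 2)) < M) at_top"
      by (rule order_tendstoD) (rule M)
    then obtain r0 where r0: "\<And>r. r \<ge> r0 \<Longrightarrow> B * exp (- \<eta> * sqrt (r / 2)) < M"
      by (auto simp: eventually_at_top_linorder)
    have "norm (f w) * exp (- \<eta> * Re (csqrt (1 + w))) \<le> M" if w: "Re w \<ge> 0" "norm w \<ge> r0" for w
    proof -
      have "norm w \<le> norm (1 + w)" using w(1) by (simp add: cmod_def power2_eq_square algebra_simps)
      then have "sqrt (norm w / 2) \<le> Re (csqrt (1 + w))" using w(1) by simp
      then have "norm (f w) * exp (- \<eta> * Re (csqrt (1 + w))) \<le> B * exp (- \<eta> * sqrt (norm w / 2))"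
        using bounded[OF w(1)] \<eta> order_trans[OF norm_ge_zero bounded[OF w(1)]]
        by (intro mult_mono) (auto intro!: mult_left_mono simp del: csqrt.sel)
      then show ?thesis using r0[OF w(2)] by simp
    qed
    then show ?thesis by blast
  qed
  show "norm (f w) \<le> M" if w: "w \<in> frontier {z. 0 \<le> Re z}" for w
  proof -
    have "open {z. 0 < Re z}" by (intro open_Collect_less continuous_intros)
    then have "{z. 0 < Re z} \<subseteq> interior {z. 0 \<le> Re z}" by (intro interior_maximal) auto
    moreover have "w \<notin> interior {z. 0 \<le> Re z}" "w \<in> {z. 0 \<le> Re z}"
      using w frontier_subset_closed[OF \<open>closed {z. 0 \<le> Re z}\<close>] by (auto simp: frontier_def)
    ultimately have "Re w = 0" by force
    then show ?thesis using bd[of "Im w"] complex_eq_iff[of w "Complex 0 (Im w)"] by simp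
  qed
qed (use z f in auto)

text \<open>Exponential type and a bound on the imaginary axis do not suffice in a half plane, as
  exp z shows. A bound on a cone around the positive axis leaves two sectors narrower than a right
  angle. The cone principle bounds \<open>f\<close> there by \<open>max M B\<close>, and the half
  plane principle then improves this to \<open>M\<close>.\<close>

lemma Phragmen_Lindelof_right_half_plane:
  fixes f :: "complex \<Rightarrow> complex"
  assumes f: "f holomorphic_on UNIV" and M: "M > 0"
    and growth: "\<And>z. Re z \<ge> 0 \<Longrightarrow> norm (f z) \<le> C * exp (K * norm z)"
    and cone: "\<And>z. \<bar>Im z\<bar> \<le> 3/4 * Re z \<Longrightarrow> norm (f z) \<le> B"
    and bd: "\<And>y. norm (f (Complex 0 y)) \<le> M" and z: "Re z \<ge> 0"
  shows "norm (f z) \<le> M"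
proof (rule Phragmen_Lindelof_half_plane[OF f M _ bd z])
  fix z :: complex assume z: "Re z \<ge> 0"
  have side: "norm (f z) \<le> max M B" if \<sigma>: "\<sigma> = 1 \<or> \<sigma> = -1" and zs: "\<sigma> * Im z \<ge> 3/4 * Re z" for \<sigma> :: real
  proof -
    \<comment> \<open>Multiplication by 1 + 2i or 1 - 2i rotates the cone of slope 1/2 onto one of
      the two sectors: one edge lands on the imaginary axis, the other on the ray of slope 3/4 or
      -3/4. This explains the slope 3/4 in the hypothesis.\<close>
    define \<omega> where "\<omega> = Complex 1 (2 * \<sigma>)"
    have \<omega>0: "\<omega> \<noteq> 0" by (simp add: \<omega>_def complex_eq_iff)
    have re: "Re (\<omega> * w) = Re w - 2 * \<sigma> * Im w" and im: "Im (\<omega> * w) = Im w + 2 * \<sigma> * Re w" for w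
      by (simp_all add: \<omega>_def)
    have f1: "(\<lambda>w. f (\<omega> * w)) holomorphic_on UNIV"
      using holomorphic_on_compose_gen[of "\<lambda>w. \<omega> * w" UNIV f UNIV] f by (simp add: o_def holomorphic_intros)
    have "norm (f (\<omega> * (z / \<omega>))) \<le> max M B"
    proof (rule Phragmen_Lindelof_cone[OF f1, of "1/2" _ C "K * norm \<omega>"])
      fix w assume w: "\<bar>Im w\<bar> \<le> 1/2 * Re w"
      have "Re (\<omega> * w) \<ge> 0" using \<sigma> w unfolding re by auto
      then show "norm (f (\<omega> * w)) \<le> C * exp (K * norm \<omega> * norm w)"
        using growth[of "\<omega> * w"] by (simp add: norm_mult mult.assoc)
    next
      fix x :: real assume x: "x \<ge> 0"
      have a: "norm (f (\<omega> * Complex x (\<sigma> * (x / 2)))) \<le> max M B"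
      proof -
        have "\<omega> * Complex x (\<sigma> * (x / 2)) = Complex 0 (Im (\<omega> * Complex x (\<sigma> * (x / 2))))"
          using \<sigma> unfolding complex_eq_iff re by auto
        then show ?thesis using bd by (metis max.coboundedI1)
      qed
      have b: "norm (f (\<omega> * Complex x (- \<sigma> * (x / 2)))) \<le> max M B"
      proof -
        have "norm (f (\<omega> * Complex x (- \<sigma> * (x / 2)))) \<le> B"
          by (rule cone, unfold re im) (use \<sigma> x in auto)
        then show ?thesis by simp
      qed
      show "norm (f (\<omega> * Complex x (1/2 * x))) \<le> max M B" "norm (f (\<omega> * Complex x (- (1/2) * x))) \<le> max M B"
        using a b \<sigma> by auto
    next
      have "\<omega> * (z / \<omega>) = z" using \<omega>0 by simp
      then have r: "Re z = Re (z / \<omega>) - 2 * \<sigma> * Im (z / \<omega>)" "Im z = Im (z / \<omega>) + 2 * \<sigma> * Re (z / \<omega>)"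
        using re[of "z / \<omega>"] im[of "z / \<omega>"] by auto
      show "\<bar>Im (z / \<omega>)\<bar> \<le> 1/2 * Re (z / \<omega>)"
        using r z zs \<sigma> by auto
    qed (use M in auto)
    then show ?thesis using \<omega>0 by simp
  qed
  consider "\<bar>Im z\<bar> \<le> 3/4 * Re z" | "Im z \<ge> 3/4 * Re z" | "- Im z \<ge> 3/4 * Re z" by linarith
  then show "norm (f z) \<le> max M B"
    using cone[of z] side[of 1] side[of "-1"] by cases (auto simp: le_max_iff_disj)
qed

section \<open>The temporal factor\<close>

text \<open>The integrand of \<open>H\<close> in the overview, with \<open>\<alpha>\<close> for the
  component of the curve in the chosen direction. The reference time \<open>t\<close> is variable
  because the argument passes from \<open>T\<close> to earlier times.\<close>

definition tfac :: "(real \<Rightarrow> real) \<Rightarrow> (real \<Rightarrow> real) \<Rightarrow> real \<Rightarrow> complex \<Rightarrow> real \<Rightarrow> complex" where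
  "tfac \<alpha> g t z s = g s * exp (z\<^sup>2 * (t - s) + z * \<alpha> s)"

lemma norm_tfac: "norm (tfac \<alpha> g t z s) = \<bar>g s\<bar> * exp (Re (z\<^sup>2) * (t - s) + Re z * \<alpha> s)"
  by (simp add: tfac_def norm_mult)

lemma tfac_shift: "tfac \<alpha> g t z s = exp (z\<^sup>2 * (t - r)) * tfac \<alpha> g r z s"
  by (simp add: tfac_def exp_add[symmetric] algebra_simps)

lemma continuous_on_tfac:
  assumes "continuous_on UNIV \<alpha>" "continuous_on UNIV g"
  shows "continuous_on S (tfac \<alpha> g t z)"
  unfolding tfac_def
  by (intro continuous_intros continuous_on_subset[OF assms(1)] continuous_on_subset[OF assms(2)]) auto

lemma tfac_integrable:
  assumes "continuous_on UNIV \<alpha>" "continuous_on UNIV g"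
  shows "tfac \<alpha> g t z integrable_on {a..b}"
  using continuous_on_tfac[OF assms] by (rule integrable_continuous_real)

lemma holomorphic_tfac_integral:
  assumes "continuous_on UNIV \<alpha>" "continuous_on UNIV g"
  shows "(\<lambda>z. integral {a..b} (tfac \<alpha> g t z)) holomorphic_on UNIV"
proof -
  define D where "D z s = of_real (g s) * (exp (z\<^sup>2 * of_real (t - s) + z * of_real (\<alpha> s)) * (2 * z * of_real (t - s) + of_real (\<alpha> s)))"
    for z :: complex and s
  have "(\<lambda>z. integral (cbox a b) (tfac \<alpha> g t z)) holomorphic_on UNIV"
  proof (rule leibniz_rule_holomorphic[where fx = D])
    show "((\<lambda>z. tfac \<alpha> g t z s) has_field_derivative D z s) (at z within UNIV)" for z s
      unfolding tfac_def D_def by (auto intro!: derivative_eq_intros)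
    show "tfac \<alpha> g t z integrable_on cbox a b" for z
      using tfac_integrable[OF assms] by simp
    have "continuous_on (UNIV \<times> cbox a b) (\<lambda>x :: complex \<times> real. \<alpha> (snd x))" "continuous_on (UNIV \<times> cbox a b) (\<lambda>x :: complex \<times> real. g (snd x))"
      by (auto intro!: continuous_on_compose2[OF assms(1)] continuous_on_compose2[OF assms(2)] continuous_intros)
    then show "continuous_on (UNIV \<times> cbox a b) (\<lambda>(z, s). D z s)"
      unfolding case_prod_unfold D_def by (intro continuous_intros)
  qed simp
  then show ?thesis by simp
qed

locale tfac_data =
  fixes \<alpha> g :: "real \<Rightarrow> real" and T C K G A :: real
  assumes cont: "continuous_on UNIV \<alpha>" "continuous_on UNIV g"
    and G: "\<And>s. s \<in> {0..T} \<Longrightarrow> \<bar>g s\<bar> \<le> G" and A: "\<And>s. s \<in> {0..T} \<Longrightarrow> \<bar>\<alpha> s\<bar> \<le> A"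
    and T: "T > 0" and C: "C \<ge> 0" and K: "K \<ge> A"
    and bound: "\<And>z. norm (integral {0..T} (tfac \<alpha> g T z)) \<le> C * exp (K * norm z)"
begin

definition H :: "real \<Rightarrow> complex \<Rightarrow> complex" where "H t z = integral {0..t} (tfac \<alpha> g t z)"

lemma nonneg: "G \<ge> 0" "A \<ge> 0" "K \<ge> 0"
  using G[of 0] A[of 0] T K by auto

lemma Re_mult_le: "s \<in> {0..T} \<Longrightarrow> Re z * \<alpha> s \<le> A * norm z"
  using mult_mono[OF A[of s] abs_Re_le_cmod[of z]] nonneg
  by (metis abs_ge_self abs_ge_zero abs_mult mult.commute order_trans)

lemma integral_tfac_le:
  assumes "0 \<le> a" "a \<le> b" "b \<le> T" and B: "\<And>s. s \<in> {a..b} \<Longrightarrow> norm (tfac \<alpha> g t z s) \<le> G * B" and "B \<ge> 0"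
  shows "norm (integral {a..b} (tfac \<alpha> g t z)) \<le> T * G * B"
proof -
  have "norm (integral {a..b} (tfac \<alpha> g t z)) \<le> integral {a..b} (\<lambda>s. G * B)"
    by (intro integral_norm_bound_integral tfac_integrable[OF cont] B integrable_const_ivl) auto
  also have "\<dots> = (b - a) * (G * B)" using assms by simp
  also have "\<dots> \<le> T * (G * B)" using assms nonneg by (intro mult_right_mono) auto
  finally show ?thesis by (simp add: mult.assoc)
qed

lemma H_split:
  assumes "0 \<le> t" "t \<le> r"
  shows "H r z = exp (z\<^sup>2 * (r - t)) * H t z + integral {t..r} (tfac \<alpha> g r z)"
proof -
  have "integral {0..t} (tfac \<alpha> g r z) = exp (z\<^sup>2 * (r - t)) * H t z"
    unfolding H_def integral_mult_right[symmetric] by (intro integral_cong tfac_shift)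
  moreover have "H r z = integral {0..t} (tfac \<alpha> g r z) + integral {t..r} (tfac \<alpha> g r z)"
    unfolding H_def using assms by (intro Henstock_Kurzweil_Integration.integral_combine[symmetric] tfac_integrable[OF cont])
  ultimately show ?thesis by simp
qed

text \<open>If Re (z^2) >= 0, \<open>H_split\<close> is solved for \<open>H t\<close>. The integral
  over the remaining interval carries at most the factor \<open>E\<close> by which
  \<open>H t\<close> is multiplied, so division by \<open>E\<close> costs nothing. If Re (z^2) < 0,
  the weight is at most 1 and \<open>H t\<close> is estimated directly.\<close>

lemma H_exponential_type:
  assumes t: "0 \<le> t" "t \<le> T"
  shows "norm (H t z) \<le> (C + T * G) * exp (K * norm z)"
proof -
  have A_le: "Re z * \<alpha> s \<le> K * norm z" if "s \<in> {0..T}" for s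
    using Re_mult_le[OF that, of z] mult_right_mono[OF K norm_ge_zero[of z]] by linarith
  show ?thesis
  proof (cases "Re (z\<^sup>2) \<ge> 0")
    case True
    define E where "E = exp (Re (z\<^sup>2) * (T - t))"
    have E: "E \<ge> 1" using True t by (simp add: E_def)
    have "norm (integral {t..T} (tfac \<alpha> g T z)) \<le> T * G * (E * exp (K * norm z))"
    proof (rule integral_tfac_le)
      fix s assume s: "s \<in> {t..T}"
      have "exp (Re (z\<^sup>2) * (T - s) + Re z * \<alpha> s) \<le> exp (Re (z\<^sup>2) * (T - t) + K * norm z)"
        using True s t A_le[of s] by (intro exp_mono add_mono mult_left_mono) auto
      then show "norm (tfac \<alpha> g T z s) \<le> G * (E * exp (K * norm z))"
        unfolding norm_tfac E_def exp_add[symmetric] using G[of s] s t nonneg by (intro mult_mono) auto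
    qed (use t E in auto)
    moreover have "E * norm (H t z) \<le> norm (H T z) + norm (integral {t..T} (tfac \<alpha> g T z))"
    proof -
      have "E * norm (H t z) = norm (exp (z\<^sup>2 * (T - t)) * H t z)" by (simp add: E_def norm_mult)
      also have "\<dots> = norm (H T z - integral {t..T} (tfac \<alpha> g T z))" using H_split[OF t, of z] by simp
      finally show ?thesis using norm_triangle_ineq4 by metis
    qed
    moreover have "norm (H T z) \<le> E * (C * exp (K * norm z))"
    proof -
      have "C * exp (K * norm z) \<le> E * (C * exp (K * norm z))"
        using E C mult_right_mono[of 1 E "C * exp (K * norm z)"] by simp
      then show ?thesis using bound[of z] by (simp add: H_def)
    qed
    ultimately have "E * norm (H t z) \<le> E * ((C + T * G) * exp (K * norm z))" by (simp add: algebra_simps)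
    then show ?thesis using E by simp
  next
    case False
    have "norm (H t z) \<le> T * G * exp (K * norm z)" unfolding H_def
    proof (rule integral_tfac_le)
      fix s assume s: "s \<in> {0..t}"
      have "Re (z\<^sup>2) * (t - s) \<le> 0" using False s by (intro mult_nonpos_nonneg) auto
      then have "exp (Re (z\<^sup>2) * (t - s) + Re z * \<alpha> s) \<le> exp (K * norm z)"
        using s t A_le[of s] by (intro exp_mono) auto
      then show "norm (tfac \<alpha> g t z s) \<le> G * exp (K * norm z)"
        unfolding norm_tfac using G[of s] s t nonneg by (intro mult_mono) auto
    qed (use t in auto)
    then show ?thesis using C by (simp add: algebra_simps add_increasing)
  qed
qed

text \<open>Solving \<open>H_split\<close> on a short interval \<open>[t, t + \<eta>]\<close> for \<open>H t\<close> bounds \<open>H t z\<close> by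
  \<open>exp (Re z (\<alpha> t + \<epsilon>))\<close> in a cone around the positive axis. On the imaginary axis \<open>H t\<close> is bounded
  directly, and Phragmen-Lindelof fills the gap.\<close>

lemma H_right_half_plane:
  assumes t: "0 \<le> t" "t < T" and z: "Re z \<ge> 0"
  shows "norm (exp (- z * \<alpha> t) * H t z) \<le> T * G + 1"
proof -
  define M where "M = T * G + 1"
  have M: "M > 0" using T nonneg by (simp add: M_def add_nonneg_pos)
  \<comment> \<open>The loss \<epsilon> accounts for the variation of \<open>\<alpha>\<close> on a
    short interval after \<open>t\<close>. It can be removed at the end because \<open>M\<close>
    does not depend on it.\<close>
  have eps: "norm (exp (- z * \<alpha> t) * H t z) \<le> M * exp (\<epsilon> * Re z)" if \<epsilon>: "\<epsilon> > 0" for \<epsilon>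
  proof -
    have "isCont \<alpha> t" using cont by (simp add: continuous_on_eq_continuous_at)
    then obtain d where d: "d > 0" "\<And>s. \<bar>s - t\<bar> < d \<Longrightarrow> \<bar>\<alpha> s - \<alpha> t\<bar> < \<epsilon>"
      using \<epsilon> unfolding continuous_at_eps_delta dist_real_def by blast
    define \<eta> where "\<eta> = min (d / 2) (T - t)"
    have \<eta>: "\<eta> > 0" "t + \<eta> \<le> T" "\<eta> < d" using d t by (auto simp: \<eta>_def)
    have near: "norm (H t w) \<le> (C + T * G) * exp (K * norm w - Re (w\<^sup>2) * \<eta>) + T * G * exp (Re w * (\<alpha> t + \<epsilon>))"
      if w: "Re w \<ge> 0" "Re (w\<^sup>2) \<ge> 0" for w
    proof -
      have eq: "integral {t..t + \<eta>} (tfac \<alpha> g (t + \<eta>) w) = exp (w\<^sup>2 * \<eta>) * integral {t..t + \<eta>} (tfac \<alpha> g t w)"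
        unfolding integral_mult_right[symmetric] using tfac_shift[of \<alpha> g "t + \<eta>" w _ t] by (intro integral_cong) simp
      have "H (t + \<eta>) w = exp (w\<^sup>2 * \<eta>) * (H t w + integral {t..t + \<eta>} (tfac \<alpha> g t w))"
        using H_split[of t "t + \<eta>" w] t \<eta> unfolding eq by (simp add: algebra_simps)
      then have "H t w = exp (- (w\<^sup>2 * \<eta>)) * H (t + \<eta>) w - integral {t..t + \<eta>} (tfac \<alpha> g t w)"
        by (simp add: exp_minus flip: mult.assoc)
      then have "norm (H t w) \<le> norm (exp (- (w\<^sup>2 * \<eta>)) * H (t + \<eta>) w) + norm (integral {t..t + \<eta>} (tfac \<alpha> g t w))"
        using norm_triangle_ineq4 by metis
      moreover have "norm (exp (- (w\<^sup>2 * \<eta>)) * H (t + \<eta>) w) \<le> exp (- (Re (w\<^sup>2) * \<eta>)) * ((C + T * G) * exp (K * norm w))"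
        using H_exponential_type[of "t + \<eta>" w] t \<eta> by (simp add: norm_mult mult_left_mono)
      moreover have "norm (integral {t..t + \<eta>} (tfac \<alpha> g t w)) \<le> T * G * exp (Re w * (\<alpha> t + \<epsilon>))"
      proof (rule integral_tfac_le)
        fix s assume s: "s \<in> {t..t + \<eta>}"
        have "\<alpha> s \<le> \<alpha> t + \<epsilon>" using d(2)[of s] s \<eta> by auto
        moreover have "Re (w\<^sup>2) * (t - s) \<le> 0" using w s by (intro mult_nonneg_nonpos) auto
        ultimately have "exp (Re (w\<^sup>2) * (t - s) + Re w * \<alpha> s) \<le> exp (Re w * (\<alpha> t + \<epsilon>))"
          using w mult_left_mono[of "\<alpha> s" "\<alpha> t + \<epsilon>" "Re w"] by (intro exp_mono) auto
        then show "norm (tfac \<alpha> g t w s) \<le> G * exp (Re w * (\<alpha> t + \<epsilon>))"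
          unfolding norm_tfac using G[of s] s t \<eta> nonneg by (intro mult_mono) auto
      qed (use t \<eta> in auto)
      moreover have "(C + T * G) * exp (K * norm w - Re (w\<^sup>2) * \<eta>) = exp (- (Re (w\<^sup>2) * \<eta>)) * ((C + T * G) * exp (K * norm w))"
        by (simp add: exp_diff exp_minus field_simps)
      ultimately show ?thesis by linarith
    qed
    define \<Phi> where "\<Phi> w = exp (- w * (\<alpha> t + \<epsilon>)) * H t w" for w :: complex
    have n\<Phi>: "norm (\<Phi> w) = exp (- Re w * (\<alpha> t + \<epsilon>)) * norm (H t w)" for w by (simp add: \<Phi>_def norm_mult)
    have le: "- Re w * (\<alpha> t + \<epsilon>) \<le> (A + \<epsilon>) * norm w" for w
    proof -
      have "\<bar>Re w * (\<alpha> t + \<epsilon>)\<bar> \<le> norm w * (A + \<epsilon>)" unfolding abs_mult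
        using A[of t] t \<epsilon> abs_Re_le_cmod by (intro mult_mono) auto
      then show ?thesis by (simp add: mult.commute)
    qed
    have "norm (\<Phi> z) \<le> M"
    proof (rule Phragmen_Lindelof_right_half_plane[OF _ M _ _ _ z])
      show "\<Phi> holomorphic_on UNIV" unfolding \<Phi>_def H_def
        by (intro holomorphic_intros holomorphic_tfac_integral cont)
      show "norm (\<Phi> w) \<le> (C + T * G) * exp ((K + A + \<epsilon>) * norm w)" for w
      proof -
        have "norm (\<Phi> w) \<le> exp ((A + \<epsilon>) * norm w) * ((C + T * G) * exp (K * norm w))"
          unfolding n\<Phi> using le H_exponential_type[of t w] t by (intro mult_mono) auto
        then show ?thesis by (simp add: exp_add algebra_simps)
      qed
      show "norm (\<Phi> (Complex 0 y)) \<le> M" for y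
      proof -
        have "norm (H t (Complex 0 y)) \<le> T * G * 1" unfolding H_def
        proof (rule integral_tfac_le)
          fix s assume s: "s \<in> {0..t}"
          have "exp (Re ((Complex 0 y)\<^sup>2) * (t - s) + Re (Complex 0 y) * \<alpha> s) \<le> 1"
            using s by (simp add: power2_eq_square)
          then show "norm (tfac \<alpha> g t (Complex 0 y) s) \<le> G * 1"
            unfolding norm_tfac using G[of s] s t nonneg by (intro mult_mono) auto
        qed (use t in auto)
        then show ?thesis by (simp add: n\<Phi> M_def)
      qed
      \<comment> \<open>In the cone of slope 3/4, Re (z^2) >= 7/25 |z|^2 because (1 - 9/16) / (1 +
        9/16) = 7/25. The exponent is then at most p r - q r^2, whose maximum over \<open>r\<close>
        is p^2 / (4 q). This bound blows up as \<open>\<eta>\<close> shrinks, which is harmless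
        because \<open>B\<close> does not enter the conclusion.\<close>
      define B where "B = (C + T * G) * exp ((K + A + \<epsilon>)\<^sup>2 / (4 * (7/25 * \<eta>))) + T * G"
      show "norm (\<Phi> w) \<le> B" if w: "\<bar>Im w\<bar> \<le> 3/4 * Re w" for w
      proof -
        have w0: "Re w \<ge> 0" using w by auto
        have "(Im w)\<^sup>2 \<le> (3/4 * Re w)\<^sup>2" using w w0 by (intro abs_le_square_iff[THEN iffD1]) auto
        then have i: "(Im w)\<^sup>2 \<le> 9/16 * (Re w)\<^sup>2" by (simp add: power_mult_distrib power2_eq_square)
        have sq: "Re (w\<^sup>2) \<ge> 7/25 * (norm w)\<^sup>2"
        proof -
          have "Re (w\<^sup>2) = (Re w)\<^sup>2 - (Im w)\<^sup>2" by (simp add: power2_eq_square)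
          then show ?thesis using i unfolding cmod_power2 by simp
        qed
        have "Re (w\<^sup>2) \<ge> 0" by (rule order_trans[OF _ sq]) simp
        have "norm (\<Phi> w) \<le> exp (- Re w * (\<alpha> t + \<epsilon>)) * ((C + T * G) * exp (K * norm w - Re (w\<^sup>2) * \<eta>)) + T * G"
          using mult_left_mono[OF near[OF w0 \<open>Re (w\<^sup>2) \<ge> 0\<close>], of "exp (- Re w * (\<alpha> t + \<epsilon>))"]
          by (simp add: n\<Phi> exp_add exp_diff exp_minus field_simps)
        also have "exp (- Re w * (\<alpha> t + \<epsilon>)) * ((C + T * G) * exp (K * norm w - Re (w\<^sup>2) * \<eta>))
          = (C + T * G) * exp (- Re w * (\<alpha> t + \<epsilon>) + K * norm w - Re (w\<^sup>2) * \<eta>)"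
          by (simp add: exp_add exp_diff exp_minus field_simps)
        also have "\<dots> \<le> (C + T * G) * exp ((K + A + \<epsilon>)\<^sup>2 / (4 * (7/25 * \<eta>)))"
        proof (intro mult_left_mono exp_mono)
          define p where "p = K + A + \<epsilon>"
          define q where "q = 7/25 * \<eta>"
          have q: "q > 0" using \<eta> by (simp add: q_def)
          have "q * (norm w)\<^sup>2 \<le> Re (w\<^sup>2) * \<eta>" unfolding q_def using mult_right_mono[OF sq, of \<eta>] \<eta> by (simp add: mult_ac)
          moreover have "p * norm w - q * (norm w)\<^sup>2 \<le> p\<^sup>2 / (4 * q)"
          proof -
            have "0 \<le> (p - 2 * q * norm w)\<^sup>2 / (4 * q)" using q by simp
            also have "\<dots> = p\<^sup>2 / (4 * q) - (p * norm w - q * (norm w)\<^sup>2)"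
              using q by (simp add: field_simps power2_eq_square)
            finally show ?thesis by simp
          qed
          ultimately show "- Re w * (\<alpha> t + \<epsilon>) + K * norm w - Re (w\<^sup>2) * \<eta> \<le> (K + A + \<epsilon>)\<^sup>2 / (4 * (7/25 * \<eta>))"
            using le[of w] unfolding p_def[symmetric] q_def[symmetric] by (simp add: p_def algebra_simps)
        qed (use C T nonneg in auto)
        finally show ?thesis by (simp add: B_def)
      qed
    qed
    moreover have "norm (\<Phi> z) = exp (- (\<epsilon> * Re z)) * norm (exp (- z * \<alpha> t) * H t z)"
    proof -
      have "exp (- Re z * (\<alpha> t + \<epsilon>)) = exp (- (\<epsilon> * Re z)) * exp (Re (- z * \<alpha> t))"
        unfolding exp_add[symmetric] by (simp add: algebra_simps)
      then show ?thesis unfolding n\<Phi> norm_mult norm_exp_eq_Re by simp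
    qed
    ultimately show ?thesis by (simp add: exp_minus divide_simps mult.commute)
  qed
  have "((\<lambda>\<epsilon>. M * exp (\<epsilon> * Re z)) \<longlongrightarrow> M * exp (0 * Re z)) (at_right 0)" by (intro tendsto_intros)
  then have "norm (exp (- z * \<alpha> t) * H t z) \<le> M * exp (0 * Re z)"
    by (rule tendsto_lowerbound) (use eps in \<open>auto simp: eventually_at_filter\<close>)
  then show ?thesis by (simp add: M_def)
qed

end

text \<open>Bounds on both half planes make the normalised \<open>H t\<close> a bounded entire
  function, hence constant. Decay along the imaginary axis identifies the constant as 0, and
  differentiating the integral of \<open>g\<close> in \<open>t\<close> gives \<open>g\<close>
  itself.\<close>

lemma temporal_factor_vanishes:
  fixes \<alpha> g :: "real \<Rightarrow> real"
  assumes cont: "continuous_on UNIV \<alpha>" "continuous_on UNIV g" and T: "T > 0" and C: "C \<ge> 0"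
    and bound: "\<And>z. norm (integral {0..T} (tfac \<alpha> g T z)) \<le> C * exp (K * norm z)"
    and t: "t \<in> {0..T}"
  shows "g t = 0"
proof -
  have "compact (g ` {0..T})" "compact (\<alpha> ` {0..T})"
    using cont continuous_on_subset by (intro compact_continuous_image; blast)+
  then have "bounded (g ` {0..T})" "bounded (\<alpha> ` {0..T})" by (simp_all add: compact_imp_bounded)
  then obtain G A where GA: "\<And>s. s \<in> {0..T} \<Longrightarrow> \<bar>g s\<bar> \<le> G" "\<And>s. s \<in> {0..T} \<Longrightarrow> \<bar>\<alpha> s\<bar> \<le> A"
    unfolding bounded_iff by (metis imageI real_norm_def)
  define K' where "K' = max K A"
  have bound': "norm (integral {0..T} (tfac \<alpha> g T z)) \<le> C * exp (K' * norm z)" for z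
    using bound[of z] by (rule order_trans) (use C in \<open>auto simp: K'_def intro!: mult_left_mono mult_right_mono\<close>)
  have refl: "tfac (\<lambda>s. - \<alpha> s) g t z = tfac \<alpha> g t (- z)" for t z by (auto simp: tfac_def)
  interpret p: tfac_data \<alpha> g T C K' G A
    by unfold_locales (use assms GA bound' in \<open>auto simp: K'_def\<close>)
  \<comment> \<open>Replacing z by -z amounts to replacing \<open>\<alpha>\<close> by its negative,
    so the estimate for the right half plane also covers the left one.\<close>
  interpret m: tfac_data "\<lambda>s. - \<alpha> s" g T C K' G A
  proof
    show "norm (integral {0..T} (tfac (\<lambda>s. - \<alpha> s) g T z)) \<le> C * exp (K' * norm z)" for z
      using bound'[of "- z"] by (simp add: refl)
  qed (use assms GA in \<open>auto simp: K'_def intro: continuous_intros\<close>)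
  have zero: "integral {0..t} g = 0" if t: "0 \<le> t" "t < T" for t
  proof -
    define \<Psi> where "\<Psi> z = exp (- z * \<alpha> t) * p.H t z" for z :: complex
    have "norm (\<Psi> z) \<le> T * G + 1" for z
    proof (cases "Re z \<ge> 0")
      case True then show ?thesis using p.H_right_half_plane[OF t] by (simp add: \<Psi>_def)
    next
      case False
      then have "norm (exp (- (- z) * - \<alpha> t) * m.H t (- z)) \<le> T * G + 1"
        using m.H_right_half_plane[OF t, of "- z"] by simp
      then show ?thesis by (simp add: \<Psi>_def m.H_def p.H_def refl)
    qed
    then have "bounded (range \<Psi>)" by (auto simp: bounded_iff)
    moreover have "\<Psi> holomorphic_on UNIV" unfolding \<Psi>_def p.H_def
      by (intro holomorphic_intros holomorphic_tfac_integral cont)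
    ultimately have "\<Psi> constant_on UNIV" by (intro Liouville_theorem)
    then obtain c where c: "\<And>z. \<Psi> z = c" by (auto simp: constant_on_def)
    \<comment> \<open>At z = iy the weight has modulus exp (- y^2 (t - s)), whose integral over
      [0,t] is at most 1 / y^2.\<close>
    have "norm c \<le> G / y\<^sup>2" if y: "y > 0" for y :: real
    proof -
      have hi: "((\<lambda>s. G * exp (- y\<^sup>2 * (t - s))) has_integral G * exp (- y\<^sup>2 * (t - t)) / y\<^sup>2 - G * exp (- y\<^sup>2 * (t - 0)) / y\<^sup>2) {0..t}"
        using y t by (intro fundamental_theorem_of_calculus)
          (auto intro!: derivative_eq_intros simp: has_real_derivative_iff_has_vector_derivative[symmetric] power2_eq_square field_simps)
      have "norm c = norm (p.H t (Complex 0 y))" unfolding c[of "Complex 0 y", symmetric] by (simp add: \<Psi>_def norm_mult)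
      also have "\<dots> \<le> integral {0..t} (\<lambda>s. G * exp (- y\<^sup>2 * (t - s)))" unfolding p.H_def
      proof (intro integral_norm_bound_integral tfac_integrable[OF cont] has_integral_integrable[OF hi])
        fix s assume "s \<in> {0..t}"
        then show "norm (tfac \<alpha> g t (Complex 0 y) s) \<le> G * exp (- y\<^sup>2 * (t - s))"
          unfolding norm_tfac using GA(1)[of s] t by (simp add: power2_eq_square)
      qed
      also have "\<dots> \<le> G / y\<^sup>2" unfolding integral_unique[OF hi] using p.nonneg by simp
      finally show ?thesis .
    qed
    moreover have "((\<lambda>y. G / y\<^sup>2) \<longlongrightarrow> 0) at_top" by real_asymp
    ultimately have "norm c \<le> 0"
      by (intro tendsto_lowerbound[of "\<lambda>y. G / y\<^sup>2" 0 at_top]) (auto intro: eventually_at_top_linorderI[of 1])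
    then have "\<Psi> 0 = 0" using c by simp
    then have "integral {0..t} (\<lambda>s. complex_of_real (g s)) = 0" by (simp add: \<Psi>_def p.H_def tfac_def[abs_def])
    moreover have "integral {0..t} (\<lambda>s. complex_of_real (g s)) = of_real (integral {0..t} g)"
      using integrable_continuous_real[OF continuous_on_subset[OF cont(2)], of 0 t]
      by (intro integral_unique has_integral_of_real) (simp add: has_integral_integral)
    ultimately show ?thesis by simp
  qed
  have open0: "g s = 0" if s: "s \<in> {0<..<T}" for s
  proof -
    have "((\<lambda>u. integral {0..u} g) has_real_derivative g s) (at s within {0..T})"
      using s by (intro integral_has_real_derivative continuous_on_subset[OF cont(2)]) auto
    then have "((\<lambda>u. integral {0..u} g) has_real_derivative g s) (at s within {0<..<T})"
      by (rule DERIV_subset) auto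
    then have "((\<lambda>u. 0) has_real_derivative g s) (at s within {0<..<T})"
      by (rule has_field_derivative_transform_within[where d = 1]) (use s zero in auto)
    then have "((\<lambda>u. 0) has_real_derivative g s) (at s)" using s by (simp add: at_within_open[of s "{0<..<T}"])
    then show ?thesis using DERIV_unique[OF _ DERIV_const] by metis
  qed
  have "closure {0<..<T} \<subseteq> {s. g s = 0}"
    by (intro closure_minimal closed_Collect_eq cont continuous_intros) (use open0 in auto)
  then show ?thesis using t T by auto
qed

section \<open>Integrals depending on a parameter\<close>

text \<open>Only the functions themselves have to be dominated locally. Cauchy's inequality on discs
  of half the radius turns this into a bound on the derivatives, hence on the difference quotients,
  and dominated convergence applies.\<close>

lemma holomorphic_on_lebesgue_integral:
  fixes f :: "complex \<Rightarrow> 'a \<Rightarrow> complex"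
  assumes S: "open S" and hol: "\<And>x. x \<in> space M \<Longrightarrow> (\<lambda>z. f z x) holomorphic_on S"
    and meas: "\<And>z. z \<in> S \<Longrightarrow> f z \<in> borel_measurable M"
    and dom: "\<And>z. z \<in> S \<Longrightarrow> \<exists>r>0. \<exists>B. integrable M B \<and> (\<forall>w\<in>cball z r. w \<in> S \<and> (\<forall>x\<in>space M. norm (f w x) \<le> B x))"
  shows "(\<lambda>z. integral\<^sup>L M (f z)) holomorphic_on S"
proof -
  have "(\<lambda>z. integral\<^sup>L M (f z)) field_differentiable at z" if z: "z \<in> S" for z
  proof -
    obtain r B where r: "r > 0" and B: "integrable M B"
      and rS: "\<And>w. w \<in> cball z r \<Longrightarrow> w \<in> S"
      and fB: "\<And>w x. w \<in> cball z r \<Longrightarrow> x \<in> space M \<Longrightarrow> norm (f w x) \<le> B x"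
      using dom[OF z] by meson
    have int: "integrable M (f w)" if w: "w \<in> cball z r" for w
    proof (rule Bochner_Integration.integrable_bound[OF B meas[OF rS[OF w]]], rule AE_I2)
      show "norm (f w x) \<le> norm (B x)" if "x \<in> space M" for x
        using fB[OF w that] by simp
    qed
    have der: "((\<lambda>z. f z x) has_field_derivative deriv (\<lambda>z. f z x) w) (at w)"
      if "w \<in> cball z r" "x \<in> space M" for w x
      by (rule holomorphic_derivI[OF hol[OF that(2)] S rS[OF that(1)]])
    have derB: "norm (deriv (\<lambda>z. f z x) w) \<le> B x / (r / 2)" if w: "w \<in> cball z (r / 2)" and x: "x \<in> space M" for w x
    proof -
      have sub: "cball w (r / 2) \<subseteq> cball z r"
        using w by (simp add: cball_subset_cball_iff dist_commute)
      have "(\<lambda>z. f z x) holomorphic_on cball w (r / 2)"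
        by (rule holomorphic_on_subset[OF hol[OF x]]) (use sub rS in blast)
      then have "norm ((deriv ^^ 1) (\<lambda>z. f z x) w) \<le> fact 1 * B x / (r / 2) ^ 1"
        using r sub fB[OF _ x]
        by (intro Cauchy_inequality holomorphic_on_imp_continuous_on)
           (auto simp: dist_norm subset_iff elim: holomorphic_on_subset)
      then show ?thesis by simp
    qed
    have lip: "norm ((f w x - f z x) / (w - z)) \<le> B x / (r / 2)"
      if w: "w \<in> cball z (r / 2)" and wz: "w \<noteq> z" and x: "x \<in> space M" for w x
    proof -
      have "norm (f w x - f z x) \<le> B x / (r / 2) * norm (w - z)"
      proof (rule field_differentiable_bound[of "cball z (r / 2)" "\<lambda>z. f z x" "deriv (\<lambda>z. f z x)"])
        show "((\<lambda>z. f z x) has_field_derivative deriv (\<lambda>z. f z x) v) (at v within cball z (r / 2))"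
          if "v \<in> cball z (r / 2)" for v
          using der[of v x] that r x by (auto intro: has_field_derivative_at_within)
      qed (use w r derB x in auto)
      then show ?thesis using wz r by (simp add: norm_divide divide_simps)
    qed
    have "((\<lambda>w. integral\<^sup>L M (\<lambda>x. (f w x - f z x) / (w - z))) \<longlongrightarrow> integral\<^sup>L M (\<lambda>x. deriv (\<lambda>z. f z x) z)) (at z)"
      unfolding tendsto_at_iff_sequentially comp_def
    proof (intro allI impI)
      fix X assume X: "\<forall>i. X i \<in> UNIV - {z}" and lim: "X \<longlonglongrightarrow> z"
      obtain N where N: "\<And>n. n \<ge> N \<Longrightarrow> dist (X n) z < r / 2"
        using lim r unfolding lim_sequentially by (meson half_gt_zero)
      have XN: "X (n + N) \<in> cball z (r / 2)" "X (n + N) \<in> cball z r" "X (n + N) \<noteq> z" for n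
        using N[of "n + N"] X r by (auto simp: dist_commute)
      have lim': "(\<lambda>n. X (n + N)) \<longlonglongrightarrow> z" using lim by (rule LIMSEQ_ignore_initial_segment)
      have q: "(\<lambda>n. (f (X (n + N)) x - f z x) / (X (n + N) - z)) \<longlonglongrightarrow> deriv (\<lambda>z. f z x) z" if "x \<in> space M" for x
        using der[of z x] that r XN(3) lim'
        unfolding has_field_derivative_iff tendsto_at_iff_sequentially comp_def by auto
      have m: "(\<lambda>x. (f (X (n + N)) x - f z x) / (X (n + N) - z)) \<in> borel_measurable M" for n
        using meas[of z] meas[of "X (n + N)"] z rS[OF XN(2)[of n]]
        by (intro borel_measurable_divide borel_measurable_diff borel_measurable_const) auto
      have "(\<lambda>n. integral\<^sup>L M (\<lambda>x. (f (X (n + N)) x - f z x) / (X (n + N) - z))) \<longlonglongrightarrow> integral\<^sup>L M (\<lambda>x. deriv (\<lambda>z. f z x) z)"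
      proof (rule integral_dominated_convergence[where w = "\<lambda>x. B x / (r / 2)"])
        show "(\<lambda>x. deriv (\<lambda>z. f z x) z) \<in> borel_measurable M"
          by (rule borel_measurable_LIMSEQ_metric[OF m q])
        show "integrable M (\<lambda>x. B x / (r / 2))" using B by simp
        show "AE x in M. (\<lambda>n. (f (X (n + N)) x - f z x) / (X (n + N) - z)) \<longlonglongrightarrow> deriv (\<lambda>z. f z x) z"
          using q by (intro AE_I2)
        show "AE x in M. norm ((f (X (n + N)) x - f z x) / (X (n + N) - z)) \<le> B x / (r / 2)" for n
          using lip[OF XN(1,3)] by (intro AE_I2)
      qed (rule m)
      then show "(\<lambda>n. integral\<^sup>L M (\<lambda>x. (f (X n) x - f z x) / (X n - z))) \<longlonglongrightarrow> integral\<^sup>L M (\<lambda>x. deriv (\<lambda>z. f z x) z)"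
        by (rule LIMSEQ_offset)
    qed
    moreover have "eventually (\<lambda>w. w \<in> ball z r) (at z)" using r by (auto simp: eventually_at dist_commute)
    then have "eventually (\<lambda>w. integral\<^sup>L M (\<lambda>x. (f w x - f z x) / (w - z)) = (integral\<^sup>L M (f w) - integral\<^sup>L M (f z)) / (w - z)) (at z)"
      by (rule eventually_mono) (use int r in simp)
    ultimately have "((\<lambda>w. (integral\<^sup>L M (f w) - integral\<^sup>L M (f z)) / (w - z)) \<longlongrightarrow> integral\<^sup>L M (\<lambda>x. deriv (\<lambda>z. f z x) z)) (at z)"
      by (rule Lim_transform_eventually)
    then show ?thesis unfolding field_differentiable_def has_field_derivative_iff by blast
  qed
  then show ?thesis using S by (auto simp: holomorphic_on_def field_differentiable_at_within)
qed

section \<open>Laplace transforms of compactly supported functions\<close>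

text \<open>The bilateral Laplace transform on the complex line through the direction
  \<open>e\<close>. At \<open>z = 1\<close> it is the usual real Laplace transform at the vector
  \<open>e\<close>.\<close>

definition laplace_ft :: "('a::euclidean_space \<Rightarrow> real) \<Rightarrow> 'a \<Rightarrow> complex \<Rightarrow> complex" where
  "laplace_ft F e z = (LINT y|lborel. of_real (F y) * exp (z * of_real (e \<bullet> y)))"

lemma laplace_bound:
  fixes z :: complex
  assumes "F y \<noteq> (0::real) \<Longrightarrow> norm y \<le> \<rho>"
  shows "norm (of_real (F y) * exp (z * of_real (e \<bullet> y))) \<le> \<bar>F y\<bar> * exp (norm e * \<rho> * norm z)"
proof (cases "F y = 0")
  case False
  have "Re z * (e \<bullet> y) \<le> \<bar>Re z\<bar> * \<bar>e \<bullet> y\<bar>" by (metis abs_ge_self abs_mult)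
  also have "\<dots> \<le> norm z * (norm e * \<rho>)"
    using assms[OF False] Cauchy_Schwarz_ineq2[of e y] mult_left_mono[of "norm y" \<rho> "norm e"] abs_Re_le_cmod[of z]
    by (intro mult_mono) auto
  finally show ?thesis by (auto simp: norm_mult mult_ac intro!: mult_left_mono)
qed simp

text \<open>The linear span of the real exponentials. A product of exponentials is again one, so
  this is an algebra, as Stone-Weierstrass requires; \<open>e = 0\<close> supplies the
  constants.\<close>

inductive exp_poly :: "('a::euclidean_space \<Rightarrow> real) \<Rightarrow> bool" where
  single: "exp_poly (\<lambda>y. c * exp (e \<bullet> y))"
| add: "exp_poly \<phi> \<Longrightarrow> exp_poly \<psi> \<Longrightarrow> exp_poly (\<lambda>y. \<phi> y + \<psi> y)"

lemma exp_poly_mult_single: "exp_poly \<phi> \<Longrightarrow> exp_poly (\<lambda>y. \<phi> y * (c * exp (e \<bullet> y)))"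
proof (induction rule: exp_poly.induct)
  case (single d e')
  have "(\<lambda>y. d * exp (e' \<bullet> y) * (c * exp (e \<bullet> y))) = (\<lambda>y. (d * c) * exp ((e' + e) \<bullet> y))"
    by (simp add: exp_add inner_add_left mult_ac)
  then show ?case using exp_poly.single by simp
qed (simp add: distrib_right exp_poly.add)

lemma exp_poly_mult: "exp_poly \<psi> \<Longrightarrow> exp_poly \<phi> \<Longrightarrow> exp_poly (\<lambda>y. \<phi> y * \<psi> y)"
  by (induction rule: exp_poly.induct) (simp_all add: exp_poly_mult_single distrib_left exp_poly.add)

lemma exp_poly_continuous: "exp_poly \<phi> \<Longrightarrow> continuous_on S \<phi>"
  by (induction rule: exp_poly.induct) (auto intro!: continuous_intros)

context
  fixes F :: "'a::euclidean_space \<Rightarrow> real" and \<rho> :: real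
  assumes F: "integrable lborel F" and supp: "\<And>y. F y \<noteq> 0 \<Longrightarrow> norm y \<le> \<rho>"
begin

lemma laplace_integrable: "integrable lborel (\<lambda>y. of_real (F y) * exp ((z :: complex) * of_real (e \<bullet> y)))"
proof (rule Bochner_Integration.integrable_bound)
  show "integrable lborel (\<lambda>y. \<bar>F y\<bar> * exp (norm e * \<rho> * norm z))" using F by simp
  show "(\<lambda>y. complex_of_real (F y) * exp (z * of_real (e \<bullet> y))) \<in> borel_measurable lborel"
    using borel_measurable_integrable[OF F] by simp
  show "AE y in lborel. norm (of_real (F y) * exp (z * of_real (e \<bullet> y))) \<le> norm (\<bar>F y\<bar> * exp (norm e * \<rho> * norm z))"
  proof (rule AE_I2)
    fix y
    show "norm (of_real (F y) * exp (z * of_real (e \<bullet> y))) \<le> norm (\<bar>F y\<bar> * exp (norm e * \<rho> * norm z))"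
      using laplace_bound[of F y \<rho> z e, OF supp] by simp
  qed
qed

lemma laplace_exponential_type:
  "norm (laplace_ft F e z) \<le> (LINT y|lborel. \<bar>F y\<bar>) * exp (norm e * \<rho> * norm z)"
proof -
  have "norm (laplace_ft F e z) \<le> (LINT y|lborel. \<bar>F y\<bar> * exp (norm e * \<rho> * norm z))"
    unfolding laplace_ft_def
    using F laplace_bound[of F _ \<rho> z e, OF supp]
    by (intro Bochner_Integration.integral_norm_bound_integral laplace_integrable) auto
  then show ?thesis by simp
qed

lemma laplace_holomorphic: "laplace_ft F e holomorphic_on UNIV"
  unfolding laplace_ft_def[abs_def]
proof (rule holomorphic_on_lebesgue_integral)
  show "\<exists>r>0. \<exists>B. integrable lborel B \<and> (\<forall>w\<in>cball z r. w \<in> UNIV \<and> (\<forall>y\<in>space lborel.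
      norm (of_real (F y) * exp (w * of_real (e \<bullet> y))) \<le> B y))" for z :: complex
  proof (intro exI[of _ 1] conjI exI[of _ "\<lambda>y. \<bar>F y\<bar> * exp (\<bar>norm e * \<rho>\<bar> * (norm z + 1))"] ballI)
    fix w :: complex and y assume w: "w \<in> cball z 1"
    have "norm w \<le> norm z + 1" using w norm_triangle_ineq2[of w z] by (auto simp: dist_norm norm_minus_commute)
    then have "norm e * \<rho> * norm w \<le> \<bar>norm e * \<rho>\<bar> * (norm z + 1)" by (intro mult_mono) auto
    then have "\<bar>F y\<bar> * exp (norm e * \<rho> * norm w) \<le> \<bar>F y\<bar> * exp (\<bar>norm e * \<rho>\<bar> * (norm z + 1))"
      by (intro mult_left_mono exp_mono) auto
    then show "norm (of_real (F y) * exp (w * of_real (e \<bullet> y))) \<le> \<bar>F y\<bar> * exp (\<bar>norm e * \<rho>\<bar> * (norm z + 1))"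
      using laplace_bound[of F y \<rho> w e, OF supp] by linarith
  qed (use F in auto)
  show "(\<lambda>y. complex_of_real (F y) * exp (z * of_real (e \<bullet> y))) \<in> borel_measurable lborel" for z
    using borel_measurable_integrable[OF F] by simp
qed (auto intro!: holomorphic_intros)

lemma laplace_real: "laplace_ft F e (of_real c) = of_real (LINT y|lborel. F y * exp (c * (e \<bullet> y)))"
  unfolding laplace_ft_def integral_complex_of_real[symmetric]
  by (simp add: exp_of_real flip: of_real_mult)

lemma laplace_real_integrable: "integrable lborel (\<lambda>y. F y * exp (e \<bullet> y))"
  using laplace_integrable[of 1 e] integrable_Re[of lborel "\<lambda>y. of_real (F y) * exp (1 * of_real (e \<bullet> y))"]
  by (simp add: exp_of_real flip: of_real_mult)

section \<open>Uniqueness for the Laplace transform\<close>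

text \<open>Continuous cutoffs approximate the indicator of a closed set, so \<open>F\<close>
  integrates to zero over closed sets. Closed sets form an intersection-stable generator, and the
  result extends to all Borel sets.\<close>

lemma zero_of_integral_continuous:
  assumes int0: "\<And>\<phi>. continuous_on UNIV \<phi> \<Longrightarrow> (LINT y|lborel. F y * \<phi> y) = 0"
  shows "AE y in lborel. F y = 0"
proof (rule sigma_finite_measure.density_zero[OF sigma_finite_lborel F])
  have Fm [measurable]: "F \<in> borel_measurable borel" using borel_measurable_integrable[OF F] by simp
  have closed: "(LINT y:S|lborel. F y) = 0" if S: "closed S" for S
  proof (cases "S = {}")
    case False
    \<comment> \<open>This equals 1 on \<open>S\<close> and, for n > 0, vanishes at distance 1/n or
      more. The empty set is treated apart because \<open>infdist y {}\<close> is 0 by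
      convention.\<close>
    define \<phi> where "\<phi> n y = max 0 (1 - real n * infdist y S)" for n y
    have lim: "(\<lambda>n. F y * \<phi> n y) \<longlonglongrightarrow> indicator S y *\<^sub>R F y" for y
    proof (cases "y \<in> S")
      case True then show ?thesis by (simp add: \<phi>_def)
    next
      case f: False
      then have d: "infdist y S > 0"
        using in_closed_iff_infdist_zero[OF S False, of y] infdist_nonneg[of y S] by linarith
      have "filterlim (\<lambda>n. real n * infdist y S) at_top sequentially"
        using d by (intro filterlim_at_top_mult_tendsto_pos[OF tendsto_const _ filterlim_real_sequentially])
      then have "eventually (\<lambda>n. real n * infdist y S \<ge> 1) sequentially"
        by (simp add: filterlim_at_top)
      then have "eventually (\<lambda>n. F y * \<phi> n y = indicator S y *\<^sub>R F y) sequentially"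
        by (rule eventually_mono) (use f in \<open>simp add: \<phi>_def\<close>)
      then show ?thesis by (rule tendsto_eventually)
    qed
    have "(\<lambda>n. LINT y|lborel. F y * \<phi> n y) \<longlonglongrightarrow> (LINT y|lborel. indicator S y *\<^sub>R F y)"
    proof (rule integral_dominated_convergence[where w = "\<lambda>y. \<bar>F y\<bar>"])
      show "integrable lborel (\<lambda>y. \<bar>F y\<bar>)" using F by simp
      have c: "continuous_on UNIV (\<phi> n)" for n unfolding \<phi>_def by (intro continuous_intros)
      show "(\<lambda>y. F y * \<phi> n y) \<in> borel_measurable lborel" for n
        using borel_measurable_continuous_onI[OF c[of n]] by simp
      show "(\<lambda>y. indicator S y *\<^sub>R F y) \<in> borel_measurable lborel" using S by simp
      show "AE y in lborel. norm (F y * \<phi> n y) \<le> \<bar>F y\<bar>" for n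
        by (rule AE_I2) (auto simp: \<phi>_def abs_mult infdist_nonneg intro!: mult_left_le)
    qed (use lim in auto)
    moreover have "(LINT y|lborel. F y * \<phi> n y) = 0" for n
      by (rule int0) (auto simp: \<phi>_def intro!: continuous_intros)
    ultimately show ?thesis by (simp add: set_lebesgue_integral_def LIMSEQ_const_iff)
  qed (simp add: set_lebesgue_integral_def)
  have si: "set_integrable lborel B F" if "B \<in> sets lborel" for B
    unfolding set_integrable_def using that F by (rule integrable_mult_indicator)
  fix S :: "'a set" assume "S \<in> sets lborel"
  then have S: "S \<in> sigma_sets UNIV (Collect closed)" by (simp add: borel_eq_closed)
  have Int: "Int_stable (Collect closed :: 'a set set)" by (auto simp: Int_stable_def)
  have sub: "Collect closed \<subseteq> Pow (UNIV :: 'a set)" by simp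
  from Int sub S show "(LINT y:S|lborel. F y) = 0"
  proof (induction rule: sigma_sets_induct_disjoint)
    case (basic A) then show ?case using closed by simp
  next
    case empty then show ?case by (simp add: set_lebesgue_integral_def)
  next
    case (compl A)
    then have A: "A \<in> sets lborel" by (simp add: borel_eq_closed)
    have "(LINT y:UNIV|lborel. F y) = (LINT y:A|lborel. F y) + (LINT y:UNIV - A|lborel. F y)"
      using A si set_integral_Un[of A "UNIV - A" lborel F] by simp
    then show ?case using compl closed[of UNIV] by simp
  next
    case (union A)
    then have A: "A i \<in> sets lborel" for i by (auto simp: borel_eq_closed)
    have "(LINT y:(\<Union>i. A i)|lborel. F y) = (\<Sum>i. LINT y:A i|lborel. F y)"
      using union.hyps A
      by (intro lebesgue_integral_countable_add si) (auto simp: disjoint_family_on_def intro!: sets.countable_UN)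
    then show ?case using union by simp
  qed
qed

text \<open>Exponentials approximate continuous functions only on compact sets, which suffices
  because \<open>F\<close> vanishes outside of the ball of radius \<open>\<rho>\<close>.\<close>

lemma laplace_uniqueness:
  assumes zero: "\<And>e. laplace_ft F e 1 = 0"
  shows "AE y in lborel. F y = 0"
proof (rule zero_of_integral_continuous)
  have Fm [measurable]: "F \<in> borel_measurable borel" using borel_measurable_integrable[OF F] by simp
  have exp0: "(LINT y|lborel. F y * exp (e \<bullet> y)) = 0" for e
    using zero[of e] laplace_real[of e 1] by simp
  have int: "integrable lborel (\<lambda>y. F y * f y)" if f: "continuous_on UNIV f" for f
  proof -
    have "compact (f ` cball 0 \<rho>)" using f continuous_on_subset by (intro compact_continuous_image) auto
    then obtain B where B: "\<And>y. norm y \<le> \<rho> \<Longrightarrow> \<bar>f y\<bar> \<le> B"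
      using compact_imp_bounded[of "f ` cball 0 \<rho>"] unfolding bounded_iff
      by (metis imageI mem_cball_0 real_norm_def)
    have B': "\<bar>F y\<bar> * \<bar>f y\<bar> \<le> \<bar>F y\<bar> * \<bar>B\<bar>" for y
      using supp[of y] B[of y] by (cases "F y = 0") (auto intro!: mult_left_mono)
    have "integrable lborel (\<lambda>y. \<bar>F y\<bar> * \<bar>B\<bar>)" using F by simp
    then show ?thesis
      by (rule Bochner_Integration.integrable_bound)
         (use borel_measurable_continuous_onI[OF f] B' in \<open>auto simp: abs_mult intro!: AE_I2\<close>)
  qed
  have P0: "(LINT y|lborel. F y * \<phi> y) = 0" if "exp_poly \<phi>" for \<phi>
    using that
  proof (induction rule: exp_poly.induct)
    case (single c e)
    have "(LINT y|lborel. F y * (c * exp (e \<bullet> y))) = c * (LINT y|lborel. F y * exp (e \<bullet> y))"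
      by (simp add: mult.left_commute)
    then show ?case by (simp add: exp0)
  next
    case (add \<phi> \<psi>)
    then show ?case using int[OF exp_poly_continuous] by (simp add: distrib_left)
  qed
  fix \<phi> :: "'a \<Rightarrow> real" assume \<phi>: "continuous_on UNIV \<phi>"
  define N where "N = (LINT y|lborel. \<bar>F y\<bar>)"
  have N: "N \<ge> 0" by (simp add: N_def)
  have "\<bar>LINT y|lborel. F y * \<phi> y\<bar> \<le> \<epsilon> * N" if \<epsilon>: "\<epsilon> > 0" for \<epsilon>
  proof -
    have "\<exists>\<psi>. exp_poly \<psi> \<and> (\<forall>y\<in>cball 0 \<rho>. \<bar>\<phi> y - \<psi> y\<bar> < \<epsilon>)"
    proof (rule Stone_Weierstrass_HOL[where P = exp_poly])
      show "exp_poly (\<lambda>x. c)" for c using exp_poly.single[of c 0] by simp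
      show "continuous_on (cball 0 \<rho>) f" if "exp_poly f" for f
        using that by (rule exp_poly_continuous)
      show "\<exists>f. exp_poly f \<and> f x \<noteq> f y" if "x \<in> cball 0 \<rho> \<and> y \<in> cball 0 \<rho> \<and> x \<noteq> y" for x y
      proof (rule exI[of _ "\<lambda>w. 1 * exp ((x - y) \<bullet> w)"], intro conjI exp_poly.single)
        have "(x - y) \<bullet> x \<noteq> (x - y) \<bullet> y" using that by (metis inner_diff_right inner_eq_zero_iff right_minus_eq)
        then show "1 * exp ((x - y) \<bullet> x) \<noteq> 1 * exp ((x - y) \<bullet> y)" by simp
      qed
      show "continuous_on (cball 0 \<rho>) \<phi>" using \<phi> continuous_on_subset by blast
    qed (use exp_poly.add exp_poly_mult \<epsilon> in auto)
    then obtain \<psi> where P: "exp_poly \<psi>" and \<psi>: "\<And>y. norm y \<le> \<rho> \<Longrightarrow> \<bar>\<phi> y - \<psi> y\<bar> < \<epsilon>" by auto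
    have c\<psi>: "continuous_on UNIV \<psi>" using P by (rule exp_poly_continuous)
    have "(LINT y|lborel. F y * \<phi> y) = (LINT y|lborel. F y * \<phi> y - F y * \<psi> y)"
      using P0[OF P] int[OF \<phi>] int[OF c\<psi>] by simp
    also have "\<bar>\<dots>\<bar> \<le> (LINT y|lborel. \<epsilon> * \<bar>F y\<bar>)"
    proof (rule integral_abs_bound_integral)
      show "integrable lborel (\<lambda>y. F y * \<phi> y - F y * \<psi> y)" using int[OF \<phi>] int[OF c\<psi>] by simp
      show "integrable lborel (\<lambda>y. \<epsilon> * \<bar>F y\<bar>)" using F by simp
      show "\<bar>F y * \<phi> y - F y * \<psi> y\<bar> \<le> \<epsilon> * \<bar>F y\<bar>" for y
      proof (cases "F y = 0")
        case False
        then have "\<bar>F y\<bar> * \<bar>\<phi> y - \<psi> y\<bar> \<le> \<bar>F y\<bar> * \<epsilon>" using \<psi>[OF supp[OF False]] by (intro mult_left_mono) auto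
        then show ?thesis by (simp add: abs_mult[symmetric] right_diff_distrib mult.commute)
      qed simp
    qed
    finally show ?thesis by (simp add: N_def)
  qed
  then have "\<bar>LINT y|lborel. F y * \<phi> y\<bar> \<le> 0"
  proof (intro tendsto_lowerbound[of "\<lambda>\<epsilon>. \<epsilon> * N" 0 "at_right 0"])
    have "((\<lambda>\<epsilon>. \<epsilon> * N) \<longlongrightarrow> 0 * N) (at_right 0)" by (intro tendsto_intros)
    then show "((\<lambda>\<epsilon>. \<epsilon> * N) \<longlongrightarrow> 0) (at_right 0)" by simp
  qed (auto simp: eventually_at_filter)
  then show "(LINT y|lborel. F y * \<phi> y) = 0" by simp
qed

end

section \<open>The heat kernel\<close>

lemma heat_kernel_nonneg: "heat_kernel x t \<ge> 0"
  by (simp add: heat_kernel_def)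

lemma heat_kernel_measurable [measurable]:
  assumes [measurable]: "f \<in> M \<rightarrow>\<^sub>M borel" "h \<in> M \<rightarrow>\<^sub>M borel"
  shows "(\<lambda>x. heat_kernel (f x) (h x)) \<in> borel_measurable M"
  unfolding heat_kernel_def by measurable

text \<open>Each coordinate contributes a centred Gaussian of variance 2t, which reduces the total
  mass to the one-dimensional normal density.\<close>

lemma heat_kernel_eq_prod:
  assumes "t > 0"
  shows "heat_kernel x t = (\<Prod>b\<in>Basis. normal_density 0 (sqrt (2 * t)) (x \<bullet> b))"
proof -
  have nd: "normal_density 0 (sqrt (2 * t)) y = 1 / sqrt (4 * pi * t) * exp (- y\<^sup>2 / (4 * t))" for y
    using assms by (simp add: normal_density_def mult_ac)
  have "(\<Prod>b\<in>(Basis :: (real^3) set). normal_density 0 (sqrt (2 * t)) (x \<bullet> b))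
      = (\<Prod>b\<in>(Basis :: (real^3) set). 1 / sqrt (4 * pi * t)) * (\<Prod>b\<in>Basis. exp (- (x \<bullet> b)\<^sup>2 / (4 * t)))"
    unfolding nd prod.distrib ..
  also have "(\<Prod>b\<in>Basis. exp (- (x \<bullet> b)\<^sup>2 / (4 * t))) = exp (- (norm x)\<^sup>2 / (4 * t))"
  proof -
    have "(norm x)\<^sup>2 = (\<Sum>b\<in>Basis. (x \<bullet> b)\<^sup>2)"
      unfolding power2_norm_eq_inner euclidean_inner[of x x] by (simp add: power2_eq_square)
    then show ?thesis by (simp add: exp_sum[symmetric] sum_divide_distrib[symmetric] sum_negf)
  qed
  also have "(\<Prod>b\<in>(Basis :: (real^3) set). 1 / sqrt (4 * pi * t)) = 1 / (4 * pi * t) powr (3/2)"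
  proof -
    have "sqrt (4 * pi * t) ^ 3 = (4 * pi * t) powr (3/2)"
      using assms by (simp add: powr_half_sqrt[symmetric] powr_powr flip: powr_numeral)
    then show ?thesis by (simp add: power_one_over)
  qed
  finally show ?thesis by (simp add: heat_kernel_def)
qed

lemma has_integral_heat_kernel:
  assumes t: "t > 0"
  shows "has_bochner_integral lborel (\<lambda>x. heat_kernel x t) 1"
proof (rule has_bochner_integral_nn_integral)
  have "(\<integral>\<^sup>+x. ennreal (heat_kernel x t) \<partial>lborel)
      = (\<integral>\<^sup>+(x :: real^3). (\<Prod>b\<in>Basis. ennreal (normal_density 0 (sqrt (2 * t)) (x \<bullet> b))) \<partial>lborel)"
    by (simp add: heat_kernel_eq_prod[OF t] prod_ennreal)
  also have "\<dots> = (\<Prod>b\<in>(Basis :: (real^3) set). (\<integral>\<^sup>+x. ennreal (normal_density 0 (sqrt (2 * t)) x) \<partial>lborel))"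
    by (intro nn_integral_lborel_prod) auto
  also have "(\<integral>\<^sup>+x. ennreal (normal_density 0 (sqrt (2 * t)) x) \<partial>lborel) = 1"
    using t by (subst nn_integral_eq_integral) auto
  finally show "(\<integral>\<^sup>+x. ennreal (heat_kernel x t) \<partial>lborel) = ennreal 1" by simp
qed (auto simp: heat_kernel_nonneg)

lemma has_bochner_integral_translate:
  fixes f :: "'a::euclidean_space \<Rightarrow> 'b::{banach, second_countable_topology}"
  assumes "has_bochner_integral lborel f I"
  shows "has_bochner_integral lborel (\<lambda>x. f (c + x)) I"
proof -
  have f: "f \<in> borel_measurable borel" using assms borel_measurable_has_bochner_integral by fastforce
  have "has_bochner_integral (distr lborel borel ((+) c)) f I" using assms by (simp add: lborel_distr_plus)
  then show ?thesis
    unfolding has_bochner_integral_iff using integrable_distr_eq[OF _ f, of "(+) c" lborel] integral_distr[OF _ f, of "(+) c" lborel]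
    by auto
qed

text \<open>Completing the square moves the centre of the Gaussian from \<open>b\<close> to b + 2 t
  v. The leftover term |v|^2 t is the origin of z^2 in \<open>tfac\<close>.\<close>

lemma heat_kernel_exp:
  assumes t: "t > 0"
  shows "has_bochner_integral lborel (\<lambda>x. heat_kernel (x - b) t * exp (v \<bullet> x)) (exp ((norm v)\<^sup>2 * t + v \<bullet> b))"
proof -
  have "heat_kernel (x - b) t * exp (v \<bullet> x) = exp ((norm v)\<^sup>2 * t + v \<bullet> b) * heat_kernel (- (b + (2 * t) *\<^sub>R v) + x) t" for x
  proof -
    have "- (norm (x - b))\<^sup>2 / (4 * t) + v \<bullet> x = ((norm v)\<^sup>2 * t + v \<bullet> b) + - (norm (- (b + (2 * t) *\<^sub>R v) + x))\<^sup>2 / (4 * t)"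
      unfolding power2_norm_eq_inner using t by (simp add: inner_simps inner_commute field_simps)
    then show ?thesis unfolding heat_kernel_def by (simp add: exp_add[symmetric])
  qed
  moreover have "has_bochner_integral lborel (\<lambda>x. exp ((norm v)\<^sup>2 * t + v \<bullet> b) * heat_kernel (- (b + (2 * t) *\<^sub>R v) + x) t) (exp ((norm v)\<^sup>2 * t + v \<bullet> b) * 1)"
    by (intro has_bochner_integral_mult_right has_bochner_integral_translate has_integral_heat_kernel t)
  ultimately show ?thesis by simp
qed

text \<open>A bound uniform in the elapsed time: at squared distance at least
  \<open>\<delta>\<close> from the source, the exponential absorbs the singularity of the kernel as
  the time tends to 0. In the variable u = \<delta> / (4 \<tau>) it says that u^(3/2) exp (-u) <=
  2.\<close>

lemma powr_exp_bound:
  fixes \<tau> \<delta> :: real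
  assumes "\<tau> > 0" "\<delta> > 0"
  shows "1 / (4 * pi * \<tau>) powr (3/2) * exp (- \<delta> / (4 * \<tau>)) \<le> 2 / (pi * \<delta>) powr (3/2)"
proof -
  define u where "u = \<delta> / (4 * \<tau>)"
  have u: "u > 0" using assms by (simp add: u_def)
  have "4 * pi * \<tau> = pi * \<delta> / u" using assms by (simp add: u_def)
  then have "1 / (4 * pi * \<tau>) powr (3/2) = u powr (3/2) / (pi * \<delta>) powr (3/2)"
    using u assms by (simp add: powr_divide)
  moreover have "u powr (3/2) \<le> 2 * exp u"
  proof (cases "u \<le> 1")
    case True
    then have "u powr (3/2) \<le> 1 powr (3/2)" using u by (intro powr_mono2) auto
    moreover have "1 \<le> exp u" using u by simp
    ultimately show ?thesis unfolding powr_one_eq_one by linarith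
  next
    case False
    then have "u powr (3/2) \<le> u powr 2" by (intro powr_mono) auto
    also have "\<dots> = u\<^sup>2" using u by simp
    also have "\<dots> \<le> 2 * exp u" using exp_lower_Taylor_quadratic[of u] u by simp
    finally show ?thesis .
  qed
  ultimately have "1 / (4 * pi * \<tau>) powr (3/2) * exp (- u) \<le> 2 * exp u / (pi * \<delta>) powr (3/2) * exp (- u)"
    by (intro mult_right_mono) (simp_all add: divide_right_mono)
  also have "\<dots> = 2 / (pi * \<delta>) powr (3/2)" by (simp add: exp_minus)
  finally show ?thesis by (simp add: u_def)
qed

lemma has_integral_prod_mult:
  fixes f :: "'a::euclidean_space \<Rightarrow> real" and h :: "'b::euclidean_space \<Rightarrow> real"
  assumes f: "integrable lborel f" and h: "integrable lborel h"
  shows "has_bochner_integral lborel (\<lambda>p. f (fst p) * h (snd p)) (integral\<^sup>L lborel f * integral\<^sup>L lborel h)"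
proof -
  have [measurable]: "f \<in> borel_measurable borel" "h \<in> borel_measurable borel"
    using f h borel_measurable_integrable by fastforce+
  have int: "integrable (lborel \<Otimes>\<^sub>M lborel) (\<lambda>p. f (fst p) * h (snd p))"
    by (rule lborel_pair.Fubini_integrable) (use f h in \<open>auto simp: abs_mult\<close>)
  have "integral\<^sup>L (lborel \<Otimes>\<^sub>M lborel) (\<lambda>p. f (fst p) * h (snd p)) = integral\<^sup>L lborel f * integral\<^sup>L lborel h"
    using lborel_pair.integral_fst'[OF int] by simp
  then show ?thesis using int unfolding has_bochner_integral_iff by (simp add: lborel_prod)
qed

section \<open>The final state\<close>

text \<open>Lebesgue measure is complete, so agreeing almost everywhere with a Borel function
  already makes \<open>f\<close> measurable.\<close>

lemma lebesgue_integral_AE_eq_borel: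
  fixes f k :: "'a::euclidean_space \<Rightarrow> real"
  assumes k: "k \<in> borel_measurable borel" and eq: "AE y in lebesgue. k y = f y"
  shows "integral\<^sup>L lebesgue f = integral\<^sup>L lborel k"
proof -
  have kl: "k \<in> borel_measurable lebesgue" using k by (intro measurable_completion) simp
  have fl: "f \<in> borel_measurable lebesgue"
  proof (rule measurableI)
    fix S :: "real set" assume "S \<in> sets borel"
    then have "k -` S \<inter> space lebesgue \<in> sets lebesgue" using kl by (rule measurable_sets[rotated])
    moreover have "AE y in lebesgue. y \<in> k -` S \<inter> space lebesgue \<longleftrightarrow> y \<in> f -` S \<inter> space lebesgue"
      using eq by eventually_elim simp
    ultimately show "f -` S \<inter> space lebesgue \<in> sets lebesgue"
      by (intro completion.in_sets_AE[of "k -` S \<inter> space lebesgue" "f -` S \<inter> space lebesgue"]) auto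
  qed simp
  have "integral\<^sup>L lebesgue f = integral\<^sup>L lebesgue k"
    by (rule integral_cong_AE[OF fl kl]) (use eq in eventually_elim, simp)
  also have "\<dots> = integral\<^sup>L lborel k" using k by (intro integral_completion) simp
  finally show ?thesis .
qed

locale moving_source =
  fixes F :: "real^3 \<Rightarrow> real" and a :: "real \<Rightarrow> real^3" and g :: "real \<Rightarrow> real" and T R1 R2 G :: real
  assumes F: "integrable lborel F" and suppF: "\<And>y. F y \<noteq> 0 \<Longrightarrow> norm y \<le> R1"
    and a: "continuous_on UNIV a" and aR: "\<And>s. norm (a s) \<le> R2"
    and g: "continuous_on UNIV g" and G: "\<And>s. \<bar>g s\<bar> \<le> G" and T: "T > 0" and R1: "R1 \<ge> 0"
begin

lemma [measurable]: "F \<in> borel_measurable borel" "a \<in> borel_measurable borel" "g \<in> borel_measurable borel"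
  using borel_measurable_integrable[OF F] borel_measurable_continuous_onI[OF a] borel_measurable_continuous_onI[OF g] by auto

text \<open>The endpoint \<open>T\<close> can be left out because \<open>heat_kernel x 0\<close> has the junk value 0. In \<open>ker\<close> the
  variable \<open>y\<close> of the Duhamel formula is translated by \<open>a s\<close>.\<close>

definition src :: "real \<times> (real^3) \<Rightarrow> real" where
  "src p = indicator {0..<T} (fst p) * g (fst p) * F (snd p)"

definition ker :: "real^3 \<Rightarrow> real \<times> (real^3) \<Rightarrow> real" where
  "ker x p = src p * heat_kernel (x - (snd p + a (fst p))) (T - fst p)"

text \<open>The \<open>W\<close> of the overview, as one integral over time and space so that the
  order of integration with \<open>x\<close> can be exchanged freely.\<close>

definition final :: "real^3 \<Rightarrow> real" where
  "final x = (LINT p|lborel. ker x p)"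

lemma src_measurable [measurable]: "src \<in> borel_measurable borel"
  unfolding src_def[abs_def] borel_prod[symmetric] by measurable

lemma src_nz: "src p \<noteq> 0 \<Longrightarrow> 0 \<le> fst p \<and> fst p < T \<and> norm (snd p + a (fst p)) \<le> R1 + R2"
  using suppF[of "snd p"] aR[of "fst p"] norm_triangle_ineq[of "snd p" "a (fst p)"]
  by (auto simp: src_def split: split_indicator_asm)

lemma src_weight_integrable:
  assumes w: "continuous_on UNIV w"
  shows "has_bochner_integral lborel (\<lambda>p. src p * (w (fst p) * exp (v \<bullet> snd p)))
    ((LINT s:{0..<T}|lborel. g s * w s) * (LINT y|lborel. F y * exp (v \<bullet> y)))"
proof -
  have "set_integrable lborel {0..T} (\<lambda>s. g s * w s)"
    by (intro borel_integrable_atLeastAtMost' continuous_intros continuous_on_subset[OF g] continuous_on_subset[OF w]) auto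
  then have "set_integrable lborel {0..<T} (\<lambda>s. g s * w s)"
    by (rule set_integrable_subset) auto
  then have "has_bochner_integral lborel (\<lambda>p. indicator {0..<T} (fst p) *\<^sub>R (g (fst p) * w (fst p)) * (F (snd p) * exp (v \<bullet> snd p)))
    ((LINT s:{0..<T}|lborel. g s * w s) * (LINT y|lborel. F y * exp (v \<bullet> y)))"
    unfolding set_integrable_def set_lebesgue_integral_def
    by (rule has_integral_prod_mult[OF _ laplace_real_integrable[OF F suppF]])
  then show ?thesis by (simp add: src_def mult_ac)
qed

lemma src_integrable: "integrable lborel src"
  using src_weight_integrable[of "\<lambda>_. 1" 0] by (simp add: has_bochner_integral_iff)

subsection \<open>Vanishing outside of a ball\<close>

lemma ker_measurable: "ker x \<in> borel_measurable borel"
proof -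
  have "(\<lambda>p. x - (snd p + a (fst p))) \<in> borel_measurable (borel \<Otimes>\<^sub>M borel)" "(\<lambda>p. T - fst p) \<in> borel_measurable (borel \<Otimes>\<^sub>M (borel :: (real^3) measure))"
    by measurable
  note m = this[unfolded borel_prod]
  show ?thesis unfolding ker_def[abs_def]
    by (intro borel_measurable_times src_measurable heat_kernel_measurable m)
qed

text \<open>A point outside of the ball keeps a positive distance from the moving support at all
  times, so the kernel stays bounded up to time \<open>T\<close>.\<close>

lemma ker_integrable:
  assumes x: "norm x > R1 + R2"
  shows "integrable lborel (ker x)"
proof -
  define \<delta> where "\<delta> = (norm x - (R1 + R2))\<^sup>2"
  have \<delta>: "\<delta> > 0" using x by (simp add: \<delta>_def)
  show ?thesis
  proof (rule Bochner_Integration.integrable_bound)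
    show "integrable lborel (\<lambda>p. src p * (2 / (pi * \<delta>) powr (3/2)))" using src_integrable by simp
    show "ker x \<in> borel_measurable lborel" using ker_measurable by simp
    show "AE p in lborel. norm (ker x p) \<le> norm (src p * (2 / (pi * \<delta>) powr (3/2)))"
    proof (rule AE_I2)
      fix p
      show "norm (ker x p) \<le> norm (src p * (2 / (pi * \<delta>) powr (3/2)))"
      proof (cases "src p = 0")
        case False
        define b where "b = snd p + a (fst p)"
        define \<tau> where "\<tau> = T - fst p"
        have b: "\<tau> > 0" "norm b \<le> R1 + R2" using src_nz[OF False] by (auto simp: b_def \<tau>_def)
        have "norm x - (R1 + R2) \<le> norm (x - b)" using norm_triangle_ineq2[of x b] b by linarith
        then have "\<delta> \<le> (norm (x - b))\<^sup>2" unfolding \<delta>_def using x by (intro power_mono) auto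
        then have "heat_kernel (x - b) \<tau> \<le> 1 / (4 * pi * \<tau>) powr (3/2) * exp (- \<delta> / (4 * \<tau>))"
          unfolding heat_kernel_def using b by (intro mult_left_mono) (auto intro!: divide_right_mono)
        also have "\<dots> \<le> 2 / (pi * \<delta>) powr (3/2)" by (rule powr_exp_bound[OF b(1) \<delta>])
        finally show ?thesis
          unfolding ker_def b_def[symmetric] \<tau>_def[symmetric] norm_mult using heat_kernel_nonneg[of "x - b" \<tau>]
          by (intro mult_left_mono) auto
      qed (simp add: ker_def)
    qed
  qed
qed

text \<open>The restriction of \<open>final\<close> to the line through \<open>p\<close> and
  \<open>x\<close> extends holomorphically to a complex parameter of modulus below 2. It vanishes
  for small positive parameters, so by the identity theorem it vanishes at 1, that is, at
  \<open>x\<close>. Thus complex analysis in one variable suffices.\<close>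

lemma final_zero_on_ball:
  assumes q: "norm q > R1 + R2" and r: "r = (norm q - (R1 + R2)) / 16"
    and p: "p \<in> ball q r" and x: "x \<in> ball q r" and p0: "eventually (\<lambda>y. final y = 0) (nhds p)"
  shows "final x = 0"
proof -
  define v where "v = x - p"
  define d where "d = norm q - (R1 + R2)"
  have d: "d > 0" "r = d / 16" using q r by (auto simp: d_def)
  \<comment> \<open>\<open>quad b\<close> continues \<open>\<bar>p + z v - b\<bar>\<^sup>2\<close> to complex \<open>z\<close>; its real part stays positive.\<close>
  define quad where "quad b z = complex_of_real ((norm (p - b))\<^sup>2) + 2 * z * of_real (v \<bullet> (p - b)) + z\<^sup>2 * of_real ((norm v)\<^sup>2)" for b z
  define \<phi> where "\<phi> z w = of_real (src w / (4 * pi * (T - fst w)) powr (3/2)) * exp (- quad (snd w + a (fst w)) z / of_real (4 * (T - fst w)))" for z w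
  have quad_real: "quad b (of_real \<sigma>) = of_real ((norm (p + \<sigma> *\<^sub>R v - b))\<^sup>2)" for b \<sigma>
  proof -
    have "(norm (p + \<sigma> *\<^sub>R v - b))\<^sup>2 = (norm (p - b))\<^sup>2 + 2 * \<sigma> * (v \<bullet> (p - b)) + \<sigma>\<^sup>2 * (norm v)\<^sup>2"
      unfolding power2_norm_eq_inner by (simp add: inner_simps inner_commute algebra_simps power2_eq_square[of \<sigma>])
    then show ?thesis by (simp add: quad_def)
  qed
  have \<phi>_real: "\<phi> (of_real \<sigma>) w = of_real (ker (p + \<sigma> *\<^sub>R v) w)" for \<sigma> w
    unfolding \<phi>_def quad_real ker_def heat_kernel_def by (simp add: exp_of_real[symmetric] algebra_simps)
  have \<phi>_int: "(LINT w|lborel. \<phi> (of_real \<sigma>) w) = of_real (final (p + \<sigma> *\<^sub>R v))" for \<sigma>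
    by (simp add: \<phi>_real final_def)
  \<comment> \<open>With r = d / 16 one has |v| < d / 8 and |p - q| < d / 16, so the real point is
    at distance at least d - d/16 - d/4 = 11 d / 16 from \<open>b\<close>. The imaginary part of
    \<open>z\<close> costs at most d^2 / 16, and 121/256 - 16/256 exceeds 1/4.\<close>
  have Re_quad: "d\<^sup>2 / 4 \<le> Re (quad b z)" if z: "norm z < 2" and b: "norm b \<le> R1 + R2" for b z
  proof -
    have pq: "norm (p - q) < r" "norm v < 2 * r"
      using p x norm_triangle_ineq4[of "x - q" "p - q"] by (auto simp: v_def dist_norm norm_minus_commute)
    have "Re (quad b z) = (norm (p + Re z *\<^sub>R v - b))\<^sup>2 - (Im z)\<^sup>2 * (norm v)\<^sup>2"
    proof -
      have "(norm (p + Re z *\<^sub>R v - b))\<^sup>2 = Re (quad b (of_real (Re z)))" by (simp only: quad_real Re_complex_of_real)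
      then show ?thesis by (simp add: quad_def algebra_simps power2_eq_square)
    qed
    moreover have "11/16 * d \<le> norm (p + Re z *\<^sub>R v - b)"
    proof -
      have "norm (Re z *\<^sub>R v) \<le> 2 * (2 * r)"
        unfolding norm_scaleR using abs_Re_le_cmod[of z] z pq by (intro mult_mono) auto
      moreover have "norm q \<le> norm (p + Re z *\<^sub>R v - b) + norm (p - q) + norm (Re z *\<^sub>R v) + norm b"
      proof -
        define X Y Z where "X = p + Re z *\<^sub>R v - b" and "Y = p - q" and "Z = Re z *\<^sub>R v"
        have "q = X - Y - Z + b" by (simp add: X_def Y_def Z_def)
        then have "norm q \<le> norm X + norm Y + norm Z + norm b"
          using norm_triangle_ineq[of "X - Y - Z" b] norm_triangle_ineq4[of "X - Y" Z] norm_triangle_ineq4[of X Y]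
          by simp
        then show ?thesis by (simp only: X_def Y_def Z_def)
      qed
      ultimately show ?thesis using pq b d(2) d_def by linarith
    qed
    then have "(11/16 * d)\<^sup>2 \<le> (norm (p + Re z *\<^sub>R v - b))\<^sup>2" using d by (intro power_mono) auto
    moreover have "(Im z)\<^sup>2 * (norm v)\<^sup>2 \<le> 2\<^sup>2 * (d / 8)\<^sup>2"
    proof (intro mult_mono)
      show "(Im z)\<^sup>2 \<le> 2\<^sup>2" using abs_Im_le_cmod[of z] z by (intro abs_le_square_iff[THEN iffD1]) auto
      show "(norm v)\<^sup>2 \<le> (d / 8)\<^sup>2" using pq d by (intro power_mono) auto
    qed auto
    ultimately show ?thesis
      by (simp add: power_mult_distrib power_divide) (use zero_le_power2[of d] in linarith)
  qed
  have hol: "(\<lambda>z. LINT w|lborel. \<phi> z w) holomorphic_on ball 0 2"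
  proof (rule holomorphic_on_lebesgue_integral)
    show "(\<lambda>z. \<phi> z w) holomorphic_on ball 0 2" for w
    proof -
      have "(\<lambda>z. k * exp (- quad b z * c)) holomorphic_on ball 0 2" for k b c
        unfolding quad_def by (intro holomorphic_intros)
      then show ?thesis unfolding \<phi>_def divide_inverse .
    qed
    show "\<phi> z \<in> borel_measurable lborel" for z
    proof -
      have [measurable]: "src \<in> borel_measurable (borel \<Otimes>\<^sub>M borel)" using src_measurable by (simp add: borel_prod)
      have "\<phi> z \<in> borel_measurable (borel \<Otimes>\<^sub>M borel)" unfolding \<phi>_def quad_def by measurable
      then show ?thesis by (simp add: borel_prod)
    qed
    define B where "B w = \<bar>src w\<bar> * (2 / (pi * (d\<^sup>2 / 4)) powr (3/2))" for w
    have B: "integrable lborel B" unfolding B_def using src_integrable by simp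
    have bound: "norm (\<phi> z w) \<le> B w" if z: "norm z < 2" for z w
    proof (cases "src w = 0")
      case False
      define \<tau> where "\<tau> = T - fst w"
      define b where "b = snd w + a (fst w)"
      have b: "\<tau> > 0" "norm b \<le> R1 + R2" using src_nz[OF False] by (auto simp: b_def \<tau>_def)
      have "norm (\<phi> z w) = \<bar>src w\<bar> * (1 / (4 * pi * \<tau>) powr (3/2) * exp (- Re (quad b z) / (4 * \<tau>)))"
        using b by (simp add: \<phi>_def b_def \<tau>_def norm_mult norm_divide del: of_real_mult of_real_diff of_real_divide)
      also have "\<dots> \<le> \<bar>src w\<bar> * (1 / (4 * pi * \<tau>) powr (3/2) * exp (- (d\<^sup>2 / 4) / (4 * \<tau>)))"
      proof -
        have "(d\<^sup>2 / 4) / (4 * \<tau>) \<le> Re (quad b z) / (4 * \<tau>)" using b by (intro divide_right_mono Re_quad z) auto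
        then show ?thesis by (intro mult_left_mono exp_mono) auto
      qed
      also have "\<dots> \<le> B w" unfolding B_def using d by (intro mult_left_mono powr_exp_bound b) auto
      finally show ?thesis .
    qed (simp add: \<phi>_def B_def)
    show "\<exists>r>0. \<exists>B. integrable lborel B \<and> (\<forall>w\<in>cball z r. w \<in> ball 0 2 \<and> (\<forall>x\<in>space lborel. norm (\<phi> w x) \<le> B x))"
      if "z \<in> ball 0 2" for z
    proof -
      obtain r where "r > 0" "cball z r \<subseteq> ball 0 2" 
        using open_contains_cball[THEN iffD1, OF open_ball, rule_format, OF \<open>z \<in> ball 0 2\<close>] by blast
      then show ?thesis using B bound by (intro exI[of _ r] conjI exI[of _ B]) (auto simp: subset_iff)
    qed
  qed simp
  obtain \<epsilon> where \<epsilon>: "\<epsilon> > 0" "\<And>y. dist y p < \<epsilon> \<Longrightarrow> final y = 0" using p0 by (auto simp: eventually_nhds_metric)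
  define \<eta> where "\<eta> = min 1 (\<epsilon> / (norm v + 1))"
  have \<eta>: "\<eta> > 0" "\<eta> \<le> 1" "\<eta> * (norm v + 1) \<le> \<epsilon>"
  proof -
    have n: "norm v + 1 > 0" by (simp add: add_nonneg_pos)
    show "\<eta> > 0" "\<eta> \<le> 1" using \<epsilon> n by (simp_all add: \<eta>_def)
    have "\<eta> * (norm v + 1) \<le> \<epsilon> / (norm v + 1) * (norm v + 1)"
      using n by (intro mult_right_mono) (simp_all add: \<eta>_def)
    then show "\<eta> * (norm v + 1) \<le> \<epsilon>" using n by simp
  qed
  have "(LINT w|lborel. \<phi> 1 w) = 0"
  proof (rule analytic_continuation[OF hol, of "of_real ` {0<..<\<eta>}" 0])
    show "of_real ` {0<..<\<eta>} \<subseteq> ball (0 :: complex) 2" using \<eta> by auto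
    show "(0 :: complex) islimpt of_real ` {0<..<\<eta>}"
      unfolding islimpt_approachable
    proof (intro allI impI)
      fix e :: real assume "e > 0"
      then have m: "min e \<eta> / 2 \<in> {0<..<\<eta>}" "0 < min e \<eta>" "min e \<eta> \<le> e" using \<eta> by auto
      show "\<exists>x'\<in>of_real ` {0<..<\<eta>}. x' \<noteq> (0 :: complex) \<and> dist x' 0 < e"
      proof (rule bexI[OF _ imageI[OF m(1)]])
        have "dist (complex_of_real (min e \<eta> / 2)) 0 = min e \<eta> / 2" using m(2) unfolding dist_0_norm norm_of_real dist_norm by simp
        then show "complex_of_real (min e \<eta> / 2) \<noteq> 0 \<and> dist (complex_of_real (min e \<eta> / 2)) 0 < e"
          using m(2,3) \<open>e > 0\<close> by (metis add_0 dist_self field_sum_of_halves half_gt_zero less_add_same_cancel1 less_irrefl order_less_le_trans)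
      qed
    qed
    fix z :: complex assume "z \<in> of_real ` {0<..<\<eta>}"
    then obtain \<sigma> where \<sigma>: "z = of_real \<sigma>" "0 < \<sigma>" "\<sigma> < \<eta>" by auto
    have "\<sigma> * norm v \<le> \<eta> * norm v" using \<sigma> by (intro mult_right_mono) auto
    then have "\<sigma> * norm v < \<epsilon>" using \<eta> by (simp add: algebra_simps)
    then show "(LINT w|lborel. \<phi> z w) = 0" using \<sigma> \<epsilon>(2)[of "p + \<sigma> *\<^sub>R v"] by (simp add: \<phi>_int dist_norm)
  qed auto
  then show ?thesis using \<phi>_int[of 1] by (simp add: v_def)
qed

text \<open>The interior of the zero set is also relatively closed in the exterior: a ball around
  \<open>q\<close> that contains one of its points lies in the zero set entirely. The exterior of a
  ball in three dimensions is connected.\<close>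

lemma final_zero_outside:
  assumes V: "open V" "V \<noteq> {}" "\<And>x. x \<in> V \<Longrightarrow> norm x > R1 + R2 \<and> final x = 0" and x: "norm x > R1 + R2"
  shows "final x = 0"
proof -
  define U where "U = - cball (0 :: real^3) (R1 + R2)"
  define Z where "Z = interior {x. final x = 0}"
  have "connected U" unfolding U_def by (rule connected_complement_bounded_convex) auto
  moreover have "open (U - Z)"
    unfolding open_contains_ball
  proof
    fix q assume q: "q \<in> U - Z"
    then have nq: "norm q > R1 + R2" by (simp add: U_def)
    define r where "r = (norm q - (R1 + R2)) / 16"
    have r: "r > 0" using nq by (simp add: r_def)
    have "p \<notin> Z" if p: "p \<in> ball q r" for p
    proof
      assume "p \<in> Z"
      then have "eventually (\<lambda>y. final y = 0) (nhds p)"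
        unfolding eventually_nhds using interior_subset[of "{x. final x = 0}"]
        by (intro exI[of _ Z]) (auto simp: Z_def)
      then have "ball q r \<subseteq> {x. final x = 0}" using final_zero_on_ball[OF nq r_def p] by auto
      then have "ball q r \<subseteq> Z" unfolding Z_def by (intro interior_maximal) auto
      then have "q \<in> Z" using r by auto
      then show False using q by simp
    qed
    moreover have "p \<in> U" if "p \<in> ball q r" for p
    proof -
      have "norm q - norm p \<le> dist q p" by (simp add: dist_norm norm_triangle_ineq2)
      then show ?thesis using that nq by (auto simp: U_def r_def)
    qed
    ultimately show "\<exists>e>0. ball q e \<subseteq> U - Z" using r by blast
  qed
  moreover have "open Z" by (simp add: Z_def)
  moreover have "Z \<inter> U \<noteq> {}"
  proof -
    have "V \<subseteq> Z" unfolding Z_def using V by (intro interior_maximal) auto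
    moreover have "V \<subseteq> U" using V(3) by (fastforce simp: U_def)
    ultimately show ?thesis using V by blast
  qed
  ultimately have "(U - Z) \<inter> U = {}" using connectedD[of U Z "U - Z"] by blast
  moreover have "x \<in> U" using x by (simp add: U_def)
  ultimately have "x \<in> Z" by blast
  then show ?thesis unfolding Z_def using interior_subset by blast
qed

subsection \<open>Factorisation of the Laplace transform\<close>

text \<open>Integrating over \<open>x\<close> first replaces the heat kernel by its exponential
  moment, after which the variables \<open>s\<close> and \<open>y\<close> separate.\<close>

lemma final_laplace:
  "has_bochner_integral lborel (\<lambda>x. final x * exp (v \<bullet> x))
    ((LINT s:{0..<T}|lborel. g s * exp ((norm v)\<^sup>2 * (T - s) + v \<bullet> a s)) * (LINT y|lborel. F y * exp (v \<bullet> y)))"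
proof -
  define w where "w s = exp ((norm v)\<^sup>2 * (T - s) + v \<bullet> a s)" for s
  have w: "continuous_on UNIV w" unfolding w_def by (intro continuous_intros a)
  define P where "P p x = ker x p * exp (v \<bullet> x)" for p x
  have Px: "has_bochner_integral lborel (P p) (src p * (w (fst p) * exp (v \<bullet> snd p)))" for p
  proof (cases "src p = 0")
    case False
    then have "T - fst p > 0" using src_nz by auto
    then have "has_bochner_integral lborel (\<lambda>x. src p * (heat_kernel (x - (snd p + a (fst p))) (T - fst p) * exp (v \<bullet> x)))
        (src p * exp ((norm v)\<^sup>2 * (T - fst p) + v \<bullet> (snd p + a (fst p))))"
      by (intro has_bochner_integral_mult_right heat_kernel_exp) auto
    then show ?thesis by (simp add: P_def[abs_def] ker_def w_def exp_add inner_add_right mult_ac)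
  qed (simp add: P_def[abs_def] ker_def has_bochner_integral_zero)
  have normP: "norm (P p x) = \<bar>src p\<bar> * (heat_kernel (x - (snd p + a (fst p))) (T - fst p) * exp (v \<bullet> x))" for p x
    by (simp add: P_def ker_def abs_mult heat_kernel_nonneg)
  have int: "integrable (lborel \<Otimes>\<^sub>M lborel) (\<lambda>(p, x). P p x)"
  proof (rule lborel_pair.Fubini_integrable)
    have [measurable]: "src \<in> borel_measurable (borel \<Otimes>\<^sub>M borel)" using src_measurable by (simp add: borel_prod)
    have "(\<lambda>q. src (fst q) * heat_kernel (snd q - (snd (fst q) + a (fst (fst q)))) (T - fst (fst q)) * exp (v \<bullet> snd q))
      \<in> borel_measurable ((borel \<Otimes>\<^sub>M borel) \<Otimes>\<^sub>M borel)"
      by measurable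
    moreover have "sets ((lborel :: (real \<times> (real^3)) measure) \<Otimes>\<^sub>M (lborel :: (real^3) measure))
      = sets (((borel :: real measure) \<Otimes>\<^sub>M (borel :: (real^3) measure)) \<Otimes>\<^sub>M borel)"
      by (intro sets_pair_measure_cong) (simp_all only: borel_prod sets_lborel)
    moreover have "(\<lambda>(p, x). P p x)
      = (\<lambda>q. src (fst q) * heat_kernel (snd q - (snd (fst q) + a (fst (fst q)))) (T - fst (fst q)) * exp (v \<bullet> snd q))"
      by (simp add: P_def ker_def fun_eq_iff)
    ultimately show "(\<lambda>(p, x). P p x) \<in> borel_measurable (lborel \<Otimes>\<^sub>M lborel)"
      by (metis measurable_cong_sets)
    show "AE p in lborel. integrable lborel (\<lambda>x. case (p, x) of (p, x) \<Rightarrow> P p x)"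
      using Px by (auto simp: has_bochner_integral_iff)
    have "integrable lborel (\<lambda>p. \<bar>src p * (w (fst p) * exp (v \<bullet> snd p))\<bar>)"
      using src_weight_integrable[OF w, of v] by (simp add: has_bochner_integral_iff del: abs_mult)
    moreover have "(LINT x|lborel. norm (P p x)) = \<bar>src p * (w (fst p) * exp (v \<bullet> snd p))\<bar>" for p
    proof -
      \<comment> \<open>The kernel is nonnegative, so the sign of \<open>P\<close> depends on
        \<open>p\<close> only and the absolute integral follows from the signed one.\<close>
      have "norm (P p x) = sgn (src p) * P p x" for x
        unfolding normP by (simp add: P_def ker_def abs_sgn)
      then have "(LINT x|lborel. norm (P p x)) = sgn (src p) * (LINT x|lborel. P p x)" by simp
      also have "\<dots> = \<bar>src p * (w (fst p) * exp (v \<bullet> snd p))\<bar>"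
        using Px[of p] by (simp add: has_bochner_integral_iff abs_mult w_def abs_sgn sgn_mult)
      finally show ?thesis .
    qed
    ultimately show "integrable lborel (\<lambda>p. LINT x|lborel. norm (case (p, x) of (p, x) \<Rightarrow> P p x))" by simp
  qed
  have "(LINT p|lborel. P p x) = final x * exp (v \<bullet> x)" for x
    by (simp add: P_def final_def)
  then have "integrable lborel (\<lambda>x. final x * exp (v \<bullet> x))"
    "(LINT x|lborel. final x * exp (v \<bullet> x)) = (LINT p|lborel. LINT x|lborel. P p x)"
    using lborel_pair.integrable_snd[OF int] lborel_pair.Fubini_integral[OF int] by simp_all
  moreover have "(LINT p|lborel. LINT x|lborel. P p x) = (LINT s:{0..<T}|lborel. g s * w s) * (LINT y|lborel. F y * exp (v \<bullet> y))"
    using Px src_weight_integrable[OF w, of v] by (simp add: has_bochner_integral_iff)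
  ultimately show ?thesis by (simp add: has_bochner_integral_iff w_def)
qed

text \<open>At real arguments this connects the complex gauge integral over the closed interval with
  the Lebesgue integral in \<open>final_laplace\<close>; the endpoint \<open>T\<close> is a null
  set.\<close>

lemma temporal_factor_real:
  assumes "norm e = 1"
  shows "integral {0..T} (tfac (\<lambda>s. e \<bullet> a s) g T (of_real c))
    = of_real (LINT s:{0..<T}|lborel. g s * exp ((norm (c *\<^sub>R e))\<^sup>2 * (T - s) + (c *\<^sub>R e) \<bullet> a s))"
proof -
  define w where "w s = g s * exp ((norm (c *\<^sub>R e))\<^sup>2 * (T - s) + (c *\<^sub>R e) \<bullet> a s)" for s
  have w: "continuous_on UNIV w" unfolding w_def by (intro continuous_intros a g)
  have [measurable]: "w \<in> borel_measurable borel" by (rule borel_measurable_continuous_onI[OF w])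
  have int: "set_integrable lborel {0..T} w"
    by (intro borel_integrable_atLeastAtMost' continuous_on_subset[OF w]) auto
  have "tfac (\<lambda>s. e \<bullet> a s) g T (of_real c) s = of_real (w s)" for s
    using assms by (simp add: tfac_def w_def exp_of_real[symmetric])
  then have "integral {0..T} (tfac (\<lambda>s. e \<bullet> a s) g T (of_real c)) = integral {0..T} (\<lambda>s. complex_of_real (w s))"
    by (intro integral_cong) simp
  also have "\<dots> = of_real (integral {0..T} w)"
    using integrable_continuous_real[OF continuous_on_subset[OF w], of 0 T]
    by (intro integral_unique has_integral_of_real) (simp add: has_integral_integral)
  also have "integral {0..T} w = (LINT s:{0..T}|lborel. w s)"
    using set_borel_integral_eq_integral(2)[OF int] by simp
  also have "\<dots> = (LINT s:{0..<T}|lborel. w s)"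
    by (rule set_integral_cong_set) (use AE_lborel_singleton[of T] in \<open>auto simp: set_borel_measurable_def\<close>)
  finally show ?thesis by (simp add: w_def)
qed

lemma source_vanishes:
  assumes V: "open V" "V \<noteq> {}" "\<And>x. x \<in> V \<Longrightarrow> norm x > R1 + R2 \<and> final x = 0" and nz: "\<exists>t\<in>{0..T}. g t \<noteq> 0"
  shows "AE y in lborel. F y = 0"
proof (rule laplace_uniqueness[OF F suppF])
  have final: "integrable lborel final" using final_laplace[of 0] by (simp add: has_bochner_integral_iff)
  have supp: "norm y \<le> R1 + R2" if "final y \<noteq> 0" for y
    using final_zero_outside[OF V, of y] that by force
  have R2: "R2 \<ge> 0" using order_trans[OF norm_ge_zero aR[of 0]] .
  have unit: "laplace_ft F e z0 = 0" if e: "norm e = 1" for e z0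
  proof (rule ccontr)
    assume z0: "laplace_ft F e z0 \<noteq> 0"
    define \<alpha> where "\<alpha> s = e \<bullet> a s" for s
    have \<alpha>: "continuous_on UNIV \<alpha>" unfolding \<alpha>_def by (intro continuous_intros a)
    define h where "h z = integral {0..T} (tfac \<alpha> g T z)" for z
    have holh: "h holomorphic_on UNIV" unfolding h_def by (rule holomorphic_tfac_integral[OF \<alpha> g])
    \<comment> \<open>For real z = c this is \<open>final_laplace\<close> at the vector c e, where
      |c e|^2 = c^2 because \<open>e\<close> is a unit vector. Both sides are entire, so the
      identity extends to all \<open>z\<close>.\<close>
    have factor: "laplace_ft final e z = laplace_ft F e z * h z" for z
    proof -
      have "laplace_ft final e z - laplace_ft F e z * h z = 0"
      proof (rule analytic_continuation[of "\<lambda>z. laplace_ft final e z - laplace_ft F e z * h z" UNIV \<real> 0])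
        show "(\<lambda>z. laplace_ft final e z - laplace_ft F e z * h z) holomorphic_on UNIV"
          by (intro holomorphic_intros holh laplace_holomorphic[OF F suppF] laplace_holomorphic[OF final supp])
        show "(0 :: complex) islimpt \<real>"
          unfolding islimpt_approachable
        proof (intro allI impI)
          fix r :: real assume "r > 0"
          then show "\<exists>x'\<in>\<real>. x' \<noteq> (0 :: complex) \<and> dist x' 0 < r"
            by (intro bexI[of _ "of_real (r / 2)"]) auto
        qed
        fix z :: complex assume "z \<in> \<real>"
        then obtain c where c: "z = of_real c" by (auto elim: Reals_cases)
        have "(LINT x|lborel. final x * exp (c * (e \<bullet> x))) = (LINT s:{0..<T}|lborel. g s * exp ((norm (c *\<^sub>R e))\<^sup>2 * (T - s) + (c *\<^sub>R e) \<bullet> a s))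
          * (LINT y|lborel. F y * exp (c * (e \<bullet> y)))"
          using final_laplace[of "c *\<^sub>R e"] unfolding has_bochner_integral_iff inner_scaleR_left by blast
        moreover have "laplace_ft final e (of_real c) = of_real (LINT x|lborel. final x * exp (c * (e \<bullet> x)))"
          by (rule laplace_real[OF final supp])
        moreover have "laplace_ft F e (of_real c) = of_real (LINT x|lborel. F x * exp (c * (e \<bullet> x)))"
          by (rule laplace_real[OF F suppF])
        ultimately show "laplace_ft final e z - laplace_ft F e z * h z = 0"
          unfolding c h_def \<alpha>_def temporal_factor_real[OF e] by simp
      qed auto
      then show ?thesis by simp
    qed
    have LF: "laplace_ft F e holomorphic_on UNIV" by (rule laplace_holomorphic[OF F suppF])
    obtain C K where CK: "C > 0" "K \<ge> 0" "\<And>z. norm (h z) \<le> C * exp (K * norm z)"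
    proof (rule exponential_type_quotient[OF LF holh z0])
      show "norm (laplace_ft F e z) \<le> (LINT y|lborel. \<bar>F y\<bar>) * exp ((R1 + R2) * norm z)" for z
      proof -
        have "norm (laplace_ft F e z) \<le> (LINT y|lborel. \<bar>F y\<bar>) * exp (R1 * norm z)"
          using laplace_exponential_type[OF F suppF, of e z] e by simp
        also have "\<dots> \<le> (LINT y|lborel. \<bar>F y\<bar>) * exp ((R1 + R2) * norm z)"
          using R2 by (intro mult_left_mono exp_mono mult_right_mono) auto
        finally show ?thesis .
      qed
      show "norm (laplace_ft F e z * h z) \<le> (LINT y|lborel. \<bar>final y\<bar>) * exp ((R1 + R2) * norm z)" for z
        using laplace_exponential_type[OF final supp, of e z] e by (simp add: factor)
      show "R1 + R2 \<ge> 0" using R1 R2 by simp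
    qed (rule that)
    have "g t = 0" if "t \<in> {0..T}" for t
      using temporal_factor_vanishes[OF \<alpha> g T, of C K t] CK that by (simp add: h_def)
    then show False using nz by blast
  qed
  show "laplace_ft F e 1 = 0" for e
  proof (cases "e = 0")
    case True
    \<comment> \<open>At \<open>e = 0\<close> the transform is the integral of \<open>F\<close>,
      which is the value at z = 0 in every unit direction.\<close>
    have "laplace_ft F e 1 = laplace_ft F (axis 1 1) 0" by (simp add: laplace_ft_def True)
    then show ?thesis using unit[of "axis 1 1"] by (simp add: norm_axis_1)
  next
    case False
    have "1 * complex_of_real (e \<bullet> y) = of_real (norm e) * of_real ((e /\<^sub>R norm e) \<bullet> y)" for y
      unfolding of_real_mult[symmetric] using False by simp
    then have "laplace_ft F e 1 = laplace_ft F (e /\<^sub>R norm e) (norm e)"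
      by (simp only: laplace_ft_def)
    then show ?thesis using unit[of "e /\<^sub>R norm e"] False by simp
  qed
qed

subsection \<open>Identification with the Duhamel formula\<close>

text \<open>The iterated integral becomes a product integral by Fubini, which relies on
  \<open>x\<close> being outside of the ball. The data of the formula need only agree with those of
  the locale almost everywhere in space and on \<open>[0,T]\<close> in time.\<close>

lemma duhamel_eq_final:
  assumes f: "AE y in lebesgue. f y = F y" and ag: "\<And>s. s \<in> {0..T} \<Longrightarrow> a' s = a s \<and> g' s = g s"
    and x: "norm x > R1 + R2"
  shows "duhamel f a' g' x T = final x"
proof -
  define J where "J s = (LINT y|lborel. heat_kernel (x - (y + a s)) (T - s) * F y * g s)" for s
  have inner: "(LINT y|lebesgue. heat_kernel (x - y) (T - s) * f (y - a' s) * g' s) = J s" if s: "s \<in> {0..T}" for s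
  proof -
    define k where "k y = heat_kernel (x - y) (T - s) * F (y - a s) * g s" for y
    have k [measurable]: "k \<in> borel_measurable borel" unfolding k_def by measurable
    have "AE y in lborel. f y = F y" using f by (simp add: AE_completion_iff)
    \<comment> \<open>Translation invariance keeps the exceptional null set null after the shift by
      \<open>a s\<close>.\<close>
    then have "AE y in distr lborel borel ((+) (- a s)). f y = F y" unfolding lborel_distr_plus .
    then have "AE y in lborel. f (- a s + y) = F (- a s + y)" by (rule AE_distrD[rotated]) simp
    then have "AE y in lebesgue. f (y - a s) = F (y - a s)" by (simp add: AE_completion_iff)
    then have "AE y in lebesgue. k y = heat_kernel (x - y) (T - s) * f (y - a' s) * g' s"
      by eventually_elim (use ag[OF s] in \<open>simp add: k_def\<close>)
    then have "(LINT y|lebesgue. heat_kernel (x - y) (T - s) * f (y - a' s) * g' s) = (LINT y|lborel. k y)"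
      by (intro lebesgue_integral_AE_eq_borel k) 
    also have "\<dots> = (LINT y|distr lborel borel ((+) (a s)). k y)" by (simp add: lborel_distr_plus)
    also have "\<dots> = (LINT y|lborel. k (a s + y))" by (subst integral_distr) auto
    also have "\<dots> = J s" by (simp add: J_def k_def add.commute)
    finally show ?thesis .
  qed
  have ker: "indicator {0..T} s *\<^sub>R J s = (LINT y|lborel. ker x (s, y))" for s
  proof (cases "s = T")
    case True
    then show ?thesis by (simp add: J_def ker_def heat_kernel_def)
  next
    case False
    then show ?thesis
      by (auto simp: J_def ker_def src_def mult_ac split: split_indicator)
  qed
  have int: "integrable (lborel \<Otimes>\<^sub>M lborel) (ker x)" using ker_integrable[OF x] by (simp add: lborel_prod)
  have "duhamel f a' g' x T = (LINT s|lebesgue. indicator {0..T} s *\<^sub>R J s)"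
    unfolding duhamel_def set_lebesgue_integral_def
  proof (intro Bochner_Integration.integral_cong refl)
    fix s
    show "indicator {0..T} s *\<^sub>R (LINT y|lebesgue. heat_kernel (x - y) (T - s) * f (y - a' s) * g' s) = indicator {0..T} s *\<^sub>R J s"
      by (cases "s \<in> {0..T}") (simp only: inner, simp)
  qed
  also have "\<dots> = (LINT s|lebesgue. LINT y|lborel. ker x (s, y))" by (simp only: ker)
  also have "\<dots> = (LINT s|lborel. LINT y|lborel. ker x (s, y))"
    using borel_measurable_integrable[OF lborel_pair.integrable_fst'[OF int]] by (intro integral_completion) simp
  also have "\<dots> = final x" using lborel_pair.integral_fst'[OF int] by (simp add: final_def lborel_prod)
  finally show ?thesis .
qed

end

section \<open>Borel representatives\<close>

text \<open>Cutting off with the indicator of the ball turns the essential support condition into a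
  pointwise one.\<close>

lemma borel_representative:
  fixes f :: "real^3 \<Rightarrow> real"
  assumes sq: "square_integrable_on f (ball 0 R)" and cs: "compactly_supported_in f (ball 0 R1)" and R: "R1 \<le> R"
  obtains F where "integrable lborel F" "\<And>y. F y \<noteq> 0 \<Longrightarrow> norm y \<le> R1" "AE y in lebesgue. f y = F y"
proof -
  define h where "h y = indicator (ball 0 R) y * f y" for y
  obtain K where K: "K \<subseteq> ball 0 R1" "AE y in lebesgue. y \<notin> K \<longrightarrow> f y = 0"
    using cs by (auto simp: compactly_supported_in_def)
  have "h \<in> borel_measurable lebesgue" using sq by (simp add: square_integrable_on_def set_borel_measurable_def h_def[abs_def])
  then obtain h' where h' [measurable]: "h' \<in> borel_measurable lborel" and hh': "AE y in lborel. h y = h' y"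
    using completion_ex_borel_measurable_real by blast
  define F where "F y = indicator (ball 0 R1) y * h' y" for y
  have [measurable]: "F \<in> borel_measurable borel" unfolding F_def[abs_def] by (intro borel_measurable_times borel_measurable_indicator) (use h' in auto)
  have hh'2: "AE y in lebesgue. h y = h' y" using hh' by (rule AE_completion)
  have eq: "AE y in lebesgue. f y = F y"
    using K(2) hh'2
  proof eventually_elim
    case (elim y)
    show ?case
    proof (cases "y \<in> K")
      case True
      then have "y \<in> ball 0 R1" "y \<in> ball 0 R" using K(1) R by auto
      then show ?thesis using elim by (simp add: F_def h_def)
    next
      case False
      then show ?thesis using elim by (simp add: F_def h_def)
    qed
  qed
  have s: "integrable lebesgue (\<lambda>y. indicator (ball 0 R) y * (f y)\<^sup>2)"
    using sq by (simp add: square_integrable_on_def set_integrable_def)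
  have i: "integrable lebesgue (\<lambda>y. indicator (ball 0 R) y :: real)"
    by (rule integrable_real_indicator) (use lmeasurable_ball[of 0 R] in \<open>auto simp: fmeasurable_def\<close>)
  have "integrable lebesgue F"
  proof (rule Bochner_Integration.integrable_bound[OF Bochner_Integration.integrable_add[OF i s]])
    show "F \<in> borel_measurable lebesgue" by (intro measurable_completion) simp
    show "AE y in lebesgue. norm (F y) \<le> norm (indicator (ball 0 R) y + indicator (ball 0 R) y * (f y)\<^sup>2)"
      using eq
    proof eventually_elim
      case (elim y)
      \<comment> \<open>On a ball of finite measure, |f| <= 1 + f^2 turns square integrability into
        integrability.\<close>
      have "\<bar>f y\<bar> \<le> 1 + (f y)\<^sup>2"
        using zero_le_power2[of "\<bar>f y\<bar> - 1"] by (simp add: power2_eq_square algebra_simps abs_mult_self_eq)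
      moreover have "F y \<noteq> 0 \<Longrightarrow> y \<in> ball 0 R" using R by (auto simp: F_def split: split_indicator_asm)
      ultimately show ?case using elim by (cases "F y = 0") auto
    qed
  qed
  then have "integrable lborel F" by (subst (asm) integrable_completion) auto
  moreover have "norm y \<le> R1" if "F y \<noteq> 0" for y using that by (auto simp: F_def indicator_def split: if_splits)
  ultimately show ?thesis using that[of F] eq by blast
qed

text \<open>If \<open>g\<close> vanished on \<open>[0,T]\<close>, Duhamel's formula would give the
  final state 0 for every profile; \<open>g_nontrivial\<close> excludes exactly this case.\<close>

theorem theorem2p2:
  fixes R1 R2 R T :: real
    and a :: "real \<Rightarrow> real^3" and g :: "real \<Rightarrow> real"
    and \<Omega> :: "(real^3) set"
    and f1 f2 :: "real^3 \<Rightarrow> real"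
    and u1 u2 :: "real^3 \<Rightarrow> real \<Rightarrow> real"
  assumes "R1 > 0" and "R2 > 0" and "R > R1 + R2" and "T > 0"
    and "C1_halfline a" and "\<And>t. t \<ge> 0 \<Longrightarrow> norm (a t) < R2"
    and "continuous_on {0..} g" and "bounded (g ` {0..})"
    and g_nontrivial: "\<exists>t\<in>{0..T}. g t \<noteq> 0"
    and "open \<Omega>" and "connected \<Omega>" and "bounded \<Omega>" and "\<Omega> \<inter> (- ball 0 R) \<noteq> {}"
    and "square_integrable_on f1 (ball 0 R)" and "compactly_supported_in f1 (ball 0 R1)"
    and "square_integrable_on f2 (ball 0 R)" and "compactly_supported_in f2 (ball 0 R1)"
    and "heat_ivp_solution f1 a g u1" and "\<And>x t. t \<ge> 0 \<Longrightarrow> u1 x t = duhamel f1 a g x t"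
    and "heat_ivp_solution f2 a g u2" and "\<And>x t. t \<ge> 0 \<Longrightarrow> u2 x t = duhamel f2 a g x t"
    and "\<And>x. x \<in> \<Omega> \<Longrightarrow> u1 x T = u2 x T"
  shows "AE x in lebesgue. f1 x = f2 x"
proof -
  \<comment> \<open>Nothing is known about \<open>a\<close> and \<open>g\<close> at negative times; clamping the time makes them continuous.\<close>
  define cl where "cl s = max 0 (min T s)" for s
  define a0 where "a0 s = a (cl s)" for s
  define g0 where "g0 s = g (cl s)" for s
  have cl: "continuous_on UNIV cl" "\<And>s. 0 \<le> cl s" "\<And>s. s \<in> {0..T} \<Longrightarrow> cl s = s"
    using \<open>T > 0\<close> unfolding cl_def by (auto intro!: continuous_intros)
  have "continuous_on {0..} a"
    using \<open>C1_halfline a\<close> unfolding C1_halfline_def continuous_on_eq_continuous_within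
    by (auto intro: has_vector_derivative_continuous)
  then have a0: "continuous_on UNIV a0" unfolding a0_def
    by (rule continuous_on_compose2) (use cl in auto)
  have g0: "continuous_on UNIV g0" unfolding g0_def
    by (rule continuous_on_compose2[OF \<open>continuous_on {0..} g\<close>]) (use cl in auto)
  obtain G where G: "\<And>s. s \<ge> 0 \<Longrightarrow> \<bar>g s\<bar> \<le> G"
    using \<open>bounded (g ` {0..})\<close> unfolding bounded_iff by (metis atLeast_iff imageI real_norm_def)
  have "R1 \<le> R" using assms(1-3) by linarith
  obtain F1 where F1: "integrable lborel F1" "\<And>y. F1 y \<noteq> 0 \<Longrightarrow> norm y \<le> R1" "AE y in lebesgue. f1 y = F1 y"
    using borel_representative[OF assms(14,15) \<open>R1 \<le> R\<close>] by blast
  obtain F2 where F2: "integrable lborel F2" "\<And>y. F2 y \<noteq> 0 \<Longrightarrow> norm y \<le> R1" "AE y in lebesgue. f2 y = F2 y"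
    using borel_representative[OF assms(16,17) \<open>R1 \<le> R\<close>] by blast
  have ag: "norm (a0 s) \<le> R2" "\<bar>g0 s\<bar> \<le> G" for s
    using assms(6)[of "cl s"] G[of "cl s"] cl(2)[of s] by (auto simp: a0_def g0_def)
  have ag0: "a s = a0 s \<and> g s = g0 s" if "s \<in> {0..T}" for s
    using cl(3)[OF that] by (simp add: a0_def g0_def)
  interpret m1: moving_source F1 a0 g0 T R1 R2 G
    by unfold_locales (use F1 a0 g0 ag assms(1,4) in auto)
  interpret m2: moving_source F2 a0 g0 T R1 R2 G
    by unfold_locales (use F2 a0 g0 ag assms(1,4) in auto)
  have supp: "norm y \<le> R1" if "F1 y - F2 y \<noteq> 0" for y
    using F1(2)[of y] F2(2)[of y] that by (cases "F1 y = 0") auto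
  interpret m: moving_source "\<lambda>y. F1 y - F2 y" a0 g0 T R1 R2 G
    by unfold_locales (use F1(1) F2(1) supp a0 g0 ag assms(1,4) in auto)
  \<comment> \<open>Additivity of the integral requires both kernels to be integrable, which is
    known outside of the ball.\<close>
  have diff: "m.final x = m1.final x - m2.final x" if "norm x > R1 + R2" for x
  proof -
    have "m.ker x p = m1.ker x p - m2.ker x p" for p
      by (simp add: m.ker_def m1.ker_def m2.ker_def m.src_def m1.src_def m2.src_def algebra_simps)
    then show ?thesis
      using m1.ker_integrable[OF that] m2.ker_integrable[OF that]
      by (simp add: m.final_def m1.final_def m2.final_def)
  qed
  define V where "V = \<Omega> \<inter> - cball 0 (R1 + R2)"
  have "AE y in lborel. F1 y - F2 y = 0"
  proof (rule m.source_vanishes)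
    show "open V" unfolding V_def using \<open>open \<Omega>\<close> by (intro open_Int open_Compl closed_cball)
    show "V \<noteq> {}" using \<open>\<Omega> \<inter> (- ball 0 R) \<noteq> {}\<close> \<open>R > R1 + R2\<close> by (force simp: V_def)
    show "\<exists>t\<in>{0..T}. g0 t \<noteq> 0" using g_nontrivial ag0 by metis
    fix x assume x: "x \<in> V"
    then have nx: "norm x > R1 + R2" by (simp add: V_def)
    have "m1.final x = u1 x T" using m1.duhamel_eq_final[OF F1(3) ag0 nx] assms(4,19) by simp
    moreover have "m2.final x = u2 x T" using m2.duhamel_eq_final[OF F2(3) ag0 nx] assms(4,21) by simp
    ultimately have "m.final x = 0" using diff[OF nx] assms(22)[of x] x by (simp add: V_def)
    with nx show "norm x > R1 + R2 \<and> m.final x = 0" ..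
  qed
  then have "AE y in lebesgue. F1 y - F2 y = 0" by (rule AE_completion)
  with F1(3) F2(3) show ?thesis by eventually_elim simp
qed

end
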